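(* Let $\mathbf{M}_L,\mathbf{M}_R,\mathbf{M}_\star\in\Omega$ be constant states, let $\sigma_L<\sigma_R$ be real numbers, and let $m_L(t)\ge0$, $m_R(t)\ge0$ be functions of $t\ge0$ with $m_L(0)=m_R(0)=0$. For $\beta\in\{L,R\}$ set $\mathbf{M}_\beta^\delta(t)=\big(m_\beta(t),\,m_\beta(t)\sigma_\beta,\,m_\beta(t)\sigma_\beta^2,\,m_\beta(t)\sigma_\beta^3\big)^t$. Consider the Riemann problem $$\partial_t\mathbf{M}+\partial_x\mathbf{F}(\mathbf{M})=0,\qquad \mathbf{M}(x,0)=\mathbf{M}_L \text{ if } x<0,\quad \mathbf{M}(x,0)=\mathbf{M}_R\text{ if }x>0,$$ and the candidate solution $$\mathbf{M}(x,t)=\begin{cases}\mathbf{M}_L & \text{if } x<\sigma_L t,\\ \mathbf{M}_L^\delta(t)\,\delta(x-\sigma_L t) & \text{if } x=\sigma_L t,\\ \mathbf{M}_\star & \text{if } \sigma_L t<x<\sigma_R t,\\ \mathbf{M}_R^\delta(t)\,\delta(x-\sigma_R t) & \text{if } x=\sigma_R t,\\ \mathbf{M}_R & \text{if } x>\sigma_R t.\end{cases}$$ (1) The candidate is a measure solution of the Riemann problem if and only if, for all $t\ge0$, $$\begin{cases}\sigma_L(\mathbf{M}_L-\mathbf{M}_\star)t-\big(\mathbf{F}(\mathbf{M}_L)-\mathbf{F}(\mathbf{M}_\star)\big)t+\mathbf{M}_L^\delta(t)=0,\\ \sigma_R(\mathbf{M}_\star-\mathbf{M}_R)t-\big(\mathbf{F}(\mathbf{M}_\star)-\mathbf{F}(\mathbf{M}_R)\big)t+\mathbf{M}_R^\delta(t)=0.\end{cases}$$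 (2) The candidate is an entropic measure solution of the Riemann problem if and only if, in addition to the identities in (1), for all $S(v)=v^{2\alpha}$ with $\alpha\in\mathbb{N}$, $\alpha\ge2$, and all $t\ge0$, $$\begin{cases}\sigma_L\big(\eta(\mathbf{M}_L)-\eta(\mathbf{M}_\star)\big)t-\big(q(\mathbf{M}_L)-q(\mathbf{M}_\star)\big)t+\eta(\mathbf{M}_L^\delta(t))\le0,\\ \sigma_R\big(\eta(\mathbf{M}_\star)-\eta(\mathbf{M}_R)\big)t-\big(q(\mathbf{M}_\star)-q(\mathbf{M}_R)\big)t+\eta(\mathbf{M}_R^\delta(t))\le0,\end{cases}$$ where $(\eta,q)$ is the entropy pair associated with $S$.
   Context: Moment space: $\Omega=\{\mathbf{M}=(M_0,M_1,M_2,M_3)^t\in\mathbb{R}^4: M_0>0,\ M_0M_2-M_1^2>0\}$. For each $\mathbf{M}\in\Omega$ there are unique $\rho_1,\rho_2>0$ and $v_1>v_2$ with $M_i=\rho_1v_1^i+\rho_2v_2^i$ for $i=0,1,2,3$. The flux is $\mathbf{F}(\mathbf{M})=(M_1,M_2,M_3,\overline{M_4})^t$ with $\overline{M_4}=\rho_1v_1^4+\rho_2v_2^4$. For a function $S:\mathbb{R}\to\mathbb{R}$ the associated pair is $\eta=\rho_1S(v_1)+\rho_2S(v_2)$, $q=\rho_1v_1S(v_1)+\rho_2v_2S(v_2)$, regarded as functions of $\mathbf{M}$. On the singular parts, $\eta(\mathbf{M}_\beta^\delta(t))=m_\beta(t)S(\sigma_\beta)$ and $q(\mathbf{M}_\beta^\delta(t))=\sigma_\beta\,\eta(\mathbf{M}_\beta^\delta(t))$,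 $\beta=L,R$. For the candidate solution, $\eta(x,t)$ equals $\eta(\mathbf{M}_L)$ for $x<\sigma_Lt$, $\eta(\mathbf{M}_\star)$ for $\sigma_Lt<x<\sigma_Rt$, $\eta(\mathbf{M}_R)$ for $x>\sigma_Rt$, together with the singular parts $\eta(\mathbf{M}_\beta^\delta(t))\,\delta(x-\sigma_\beta t)$ on $x=\sigma_\beta t$, $\beta=L,R$; $q(x,t)$ is defined in the same way with $q$ in place of $\eta$. The relation $\partial_t\eta+\partial_xq=0$ in $\mathcal{D}'(]0,\infty[\times\mathbb{R})$ means $-\langle\eta,\partial_t\varphi\rangle-\langle q,\partial_x\varphi\rangle=0$ for every $\varphi\in C_c^\infty(]0,\infty[\times\mathbb{R})$, the singular parts contributing $\int_0^\infty\eta(\mathbf{M}_\beta^\delta(t))\,\partial_t\varphi(\sigma_\beta t,t)\,dt$ and $\int_0^\infty q(\mathbf{M}_\beta^\delta(t))\,\partial_x\varphi(\sigma_\beta t,t)\,dt$; the relation $\le0$ is understood in the usual way, with $\varphi\ge0$. Definitions. The candidate is a measure solution if and only if $\partial_t\eta+\partial_xq=0$ in $\mathcal{D}'(]0,\infty[\times\mathbb{R})$ for $S(v)=v^{2\alpha}$ with $\alpha=0,\frac12,1,\frac32$, that is for $(\eta,q)=(M_i,M_{i+1})$, $i=0,1,2,3$ (with $M_4$ meaning $\overline{M_4}$). It is an entropic measure solution if and only if $\partial_t\eta+\partial_xq\le0$ in $\mathcal{D}'(]0,\infty[\times\mathbb{R})$ for $S(v)=v^{2\alpha}$ with $\alpha=0,\frac12,1,\frac32$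 and with $\alpha\in\mathbb{N}$, $\alpha\ge2$.
   Formalization: The masses m_L, m_R are assumed continuous on t≥0 (else adding 1 for t>0 breaks (1)), and an entropic measure solution is required to be a measure solution as well as satisfy the inequalities, since the inequalities alone do not imply the identities in (1). *)

theory Defs
  imports "HOL-Analysis.Analysis"
begin

text \<open>
  Moment vectors live in \<open>real ^ 4\<close> and are indexed by 0, 1, 2, 3. In the index type \<open>4\<close> numerals
  are read modulo 4, so these are its four distinct elements (and \<open>$ 4\<close> would mean \<open>$ 0\<close>).
\<close>

definition vec4 :: "real \<Rightarrow> real \<Rightarrow> real \<Rightarrow> real \<Rightarrow> real ^ 4" where
  "vec4 a b c d = (\<chi> i. if i = 0 then a else if i = 1 then b else if i = 2 then c else d)"

lemma vec4_nth [simp]: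
  "vec4 a b c d $ 0 = a" "vec4 a b c d $ 1 = b" "vec4 a b c d $ 2 = c" "vec4 a b c d $ 3 = d"
  by (simp_all add: vec4_def)

lemma vec4_eq_iff: "M = vec4 a b c d \<longleftrightarrow> M $ 0 = a \<and> M $ 1 = b \<and> M $ 2 = c \<and> M $ 3 = d"
proof -
  have [simp]: "(4 :: 4) = 0" by simp
  have "(\<forall>i::4. P i) \<longleftrightarrow> P 0 \<and> P 1 \<and> P 2 \<and> P 3" for P
    unfolding forall_4 \<open>4 = 0\<close> by blast
  then show ?thesis by (simp add: vec_eq_iff)
qed

definition moment_space :: "(real ^ 4) set" where
  "moment_space = {M. M $ 0 > 0 \<and> M $ 0 * M $ 2 - (M $ 1)\<^sup>2 > 0}"

fun is_quadrature :: "real ^ 4 \<Rightarrow> real \<times> real \<times> real \<times> real \<Rightarrow> bool" where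
  "is_quadrature M (\<rho>1, \<rho>2, v1, v2) \<longleftrightarrow>
     \<rho>1 > 0 \<and> \<rho>2 > 0 \<and> v1 > v2 \<and>
     M = vec4 (\<rho>1 * v1 ^ 0 + \<rho>2 * v2 ^ 0) (\<rho>1 * v1 ^ 1 + \<rho>2 * v2 ^ 1)
              (\<rho>1 * v1 ^ 2 + \<rho>2 * v2 ^ 2) (\<rho>1 * v1 ^ 3 + \<rho>2 * v2 ^ 3)"

lemma quadrature_ex1:
  assumes "M \<in> moment_space"
  shows "\<exists>!z. is_quadrature M z"
proof -
  define a b c d where "a = M $ 0" and "b = M $ 1" and "c = M $ 2" and "d = M $ 3"
  note defs = a_def b_def c_def d_def
  have a: "a > 0" and e: "a * c - b\<^sup>2 > 0"
    using assms by (auto simp: moment_space_def defs)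
  define s p where "s = (a * d - b * c) / (a * c - b\<^sup>2)" and "p = (b * d - c\<^sup>2) / (a * c - b\<^sup>2)"
  have s: "s * (a * c - b\<^sup>2) = a * d - b * c" and p: "p * (a * c - b\<^sup>2) = b * d - c\<^sup>2"
    using e by (simp_all add: s_def p_def)
  have rec1: "c - s * b + p * a = 0"
  proof -
    have "(c - s * b + p * a) * (a * c - b\<^sup>2) = 0"
      using s p by algebra
    then show ?thesis using e by simp
  qed
  have rec2: "d - s * c + p * b = 0"
  proof -
    have "(d - s * c + p * b) * (a * c - b\<^sup>2) = 0"
      using s p by algebra
    then show ?thesis using e by simp
  qed
  define D where "D = sqrt (s\<^sup>2 - 4 * p)"
  have disc: "s\<^sup>2 - 4 * p > (s - 2 * b / a)\<^sup>2"
  proof -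
    have "a\<^sup>2 * (s\<^sup>2 - 4 * p) - (a * s - 2 * b)\<^sup>2 = 4 * (a * c - b\<^sup>2)"
      using rec1 by algebra
    then have "(a * s - 2 * b)\<^sup>2 < a\<^sup>2 * (s\<^sup>2 - 4 * p)"
      using e by (metis diff_gt_0_iff_gt mult_pos_pos zero_less_numeral)
    moreover have "(a * s - 2 * b)\<^sup>2 = a\<^sup>2 * (s - 2 * b / a)\<^sup>2"
      using a by (simp add: field_simps power2_eq_square)
    ultimately show ?thesis using a by simp
  qed
  have "sqrt ((s - 2 * b / a)\<^sup>2) < D"
    unfolding D_def using disc by (rule real_sqrt_less_mono)
  then have D: "\<bar>s - 2 * b / a\<bar> < D" by simp
  then have Dpos: "D > 0" by linarith
  have D2: "D\<^sup>2 = s\<^sup>2 - 4 * p"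
    using order.strict_trans1[OF zero_le_power2 disc] by (simp add: D_def)
  define v1 v2 where "v1 = (s + D) / 2" and "v2 = (s - D) / 2"
  define r1 r2 where "r1 = (b - a * v2) / D" and "r2 = (a * v1 - b) / D"
  have sp: "v1 + v2 = s" "v1 - v2 = D" "v1 * v2 = p"
    using D2 by (simp_all add: v1_def v2_def field_simps power2_eq_square)
  have bnd: "v2 < b / a" "b / a < v1"
    using D unfolding v1_def v2_def by (simp_all add: abs_less_iff field_simps)
  have r: "r1 > 0" "r2 > 0"
    using bnd a Dpos by (simp_all add: r1_def r2_def field_simps)
  have r': "r1 * D = b - a * v2" "r2 * D = a * v1 - b"
    using Dpos by (simp_all add: r1_def r2_def)
  have m0: "a = r1 + r2" and m1: "b = r1 * v1 + r2 * v2"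
    and m2: "c = r1 * v1\<^sup>2 + r2 * v2\<^sup>2" and m3: "d = r1 * v1 ^ 3 + r2 * v2 ^ 3"
  proof -
    have "(r1 + r2) * D = a * D" using r' sp by algebra
    then show m0: "a = r1 + r2" using Dpos by simp
    have "(r1 * v1 + r2 * v2) * D = b * D" using r' sp by algebra
    then show m1: "b = r1 * v1 + r2 * v2" using Dpos by simp
    show m2: "c = r1 * v1\<^sup>2 + r2 * v2\<^sup>2" using rec1 m0 m1 sp by algebra
    show "d = r1 * v1 ^ 3 + r2 * v2 ^ 3" using rec2 m1 m2 sp by algebra
  qed
  show ?thesis
  proof (rule ex1I)
    show "is_quadrature M (r1, r2, v1, v2)"
      using r sp Dpos m0 m1 m2 m3
      by (simp add: vec4_eq_iff flip: defs)
  next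
    fix z assume z: "is_quadrature M z"
    obtain x1 x2 w1 w2 where z_eq: "z = (x1, x2, w1, w2)" by (cases z)
    have x: "w1 > w2"
      and n: "a = x1 + x2" "b = x1 * w1 + x2 * w2"
        "c = x1 * w1\<^sup>2 + x2 * w2\<^sup>2" "d = x1 * w1 ^ 3 + x2 * w2 ^ 3"
      using z by (auto simp: z_eq defs)
    have "(w1 + w2) * (a * c - b\<^sup>2) = s * (a * c - b\<^sup>2)" unfolding s using n by algebra
    then have ws: "w1 + w2 = s" using e by simp
    have "w1 * w2 * (a * c - b\<^sup>2) = p * (a * c - b\<^sup>2)" unfolding p using n by algebra
    then have wp: "w1 * w2 = p" using e by simp
    have "(w1 - w2)\<^sup>2 = D\<^sup>2"
      unfolding D2 ws[symmetric] wp[symmetric] by (simp add: power2_eq_square algebra_simps)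
    then have wd: "w1 - w2 = D" using x Dpos by (simp add: power2_eq_iff)
    have w: "w1 = v1" "w2 = v2" using ws wd sp by linarith+
    have "x1 * D = r1 * D" "x2 * D = r2 * D" using n w r' sp by algebra+
    then show "z = (r1, r2, v1, v2)" using w Dpos by (simp add: z_eq)
  qed
qed

definition quadrature :: "real ^ 4 \<Rightarrow> real \<times> real \<times> real \<times> real" where
  "quadrature M = (THE z. is_quadrature M z)"

definition eta :: "(real \<Rightarrow> real) \<Rightarrow> real ^ 4 \<Rightarrow> real" where
  "eta S M = (case quadrature M of (\<rho>1, \<rho>2, v1, v2) \<Rightarrow> \<rho>1 * S v1 + \<rho>2 * S v2)"

definition q :: "(real \<Rightarrow> real) \<Rightarrow> real ^ 4 \<Rightarrow> real" where
  "q S M = (case quadrature M of (\<rho>1, \<rho>2, v1, v2) \<Rightarrow> \<rho>1 * v1 * S v1 + \<rho>2 * v2 * S v2)"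

definition M4_bar :: "real ^ 4 \<Rightarrow> real" where
  "M4_bar M = (case quadrature M of (\<rho>1, \<rho>2, v1, v2) \<Rightarrow> \<rho>1 * v1 ^ 4 + \<rho>2 * v2 ^ 4)"

definition flux :: "real ^ 4 \<Rightarrow> real ^ 4" where
  "flux M = vec4 (M $ 1) (M $ 2) (M $ 3) (M4_bar M)"

definition M_delta :: "(real \<Rightarrow> real) \<Rightarrow> real \<Rightarrow> real \<Rightarrow> real ^ 4" where
  "M_delta m \<sigma> t = vec4 (m t) (m t * \<sigma>) (m t * \<sigma>\<^sup>2) (m t * \<sigma> ^ 3)"

text \<open>
  \<open>M_delta m \<sigma> t\<close> lies outside the moment space, so \<open>eta\<close> and \<open>q\<close> do not apply to it. Its entropy
  and entropy flux are those of a single atom of mass \<open>m t\<close> at velocity \<open>\<sigma>\<close>.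
\<close>

definition eta_delta :: "(real \<Rightarrow> real) \<Rightarrow> (real \<Rightarrow> real) \<Rightarrow> real \<Rightarrow> real \<Rightarrow> real" where
  "eta_delta S m \<sigma> t = m t * S \<sigma>"

definition q_delta :: "(real \<Rightarrow> real) \<Rightarrow> (real \<Rightarrow> real) \<Rightarrow> real \<Rightarrow> real \<Rightarrow> real" where
  "q_delta S m \<sigma> t = \<sigma> * eta_delta S m \<sigma> t"

text \<open>
  Points of space-time are written \<open>(x, t)\<close>. Test functions on the open half plane \<open>t > 0\<close> are
  represented by their extension by zero to the whole plane.
\<close>

definition pd_x :: "(real \<times> real \<Rightarrow> real) \<Rightarrow> real \<times> real \<Rightarrow> real" where
  "pd_x \<phi> p = frechet_derivative \<phi> (at p) (1, 0)"

definition pd_t :: "(real \<times> real \<Rightarrow> real) \<Rightarrow> real \<times> real \<Rightarrow> real" where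
  "pd_t \<phi> p = frechet_derivative \<phi> (at p) (0, 1)"

fun C_k :: "nat \<Rightarrow> (real \<times> real \<Rightarrow> real) \<Rightarrow> bool" where
  "C_k 0 \<phi> \<longleftrightarrow> continuous_on UNIV \<phi>"
| "C_k (Suc k) \<phi> \<longleftrightarrow> \<phi> differentiable_on UNIV \<and> C_k k (pd_x \<phi>) \<and> C_k k (pd_t \<phi>)"

definition test_function :: "(real \<times> real \<Rightarrow> real) \<Rightarrow> bool" where
  "test_function \<phi> \<longleftrightarrow> (\<forall>k. C_k k \<phi>) \<and>
     compact (closure {p. \<phi> p \<noteq> 0}) \<and> closure {p. \<phi> p \<noteq> 0} \<subseteq> UNIV \<times> {0<..}"

text \<open>
  The distribution with constant densities \<open>uL\<close>, \<open>uS\<close>, \<open>uR\<close> in the three sectors and singular parts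
  \<open>wL t \<cdot> \<delta>(x - \<sigma>L t)\<close>, \<open>wR t \<cdot> \<delta>(x - \<sigma>R t)\<close> on the two rays. The density is set to 0 on the rays;
  these are null sets for the area integral.
\<close>

definition sector_density ::
  "real \<Rightarrow> real \<Rightarrow> real \<Rightarrow> real \<Rightarrow> real \<Rightarrow> real \<times> real \<Rightarrow> real" where
  "sector_density \<sigma>L \<sigma>R uL uS uR = (\<lambda>(x, t).
     if x < \<sigma>L * t then uL
     else if \<sigma>L * t < x \<and> x < \<sigma>R * t then uS
     else if x > \<sigma>R * t then uR
     else 0)"

definition pairing ::
  "real \<Rightarrow> real \<Rightarrow> real \<Rightarrow> real \<Rightarrow> real \<Rightarrow> (real \<Rightarrow> real) \<Rightarrow> (real \<Rightarrow> real) \<Rightarrow>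
   (real \<times> real \<Rightarrow> real) \<Rightarrow> real" where
  "pairing \<sigma>L \<sigma>R uL uS uR wL wR \<psi> =
     (LINT p:UNIV \<times> {0<..}|lborel. sector_density \<sigma>L \<sigma>R uL uS uR p * \<psi> p)
     + (LINT t:{0<..}|lborel. wL t * \<psi> (\<sigma>L * t, t))
     + (LINT t:{0<..}|lborel. wR t * \<psi> (\<sigma>R * t, t))"

text \<open>The value at \<open>\<phi>\<close> of the distribution \<open>\<partial>\<^sub>t \<eta> + \<partial>\<^sub>x q\<close> for the candidate and the function \<open>S\<close>.\<close>

definition entropy_production ::
  "real ^ 4 \<Rightarrow> real ^ 4 \<Rightarrow> real ^ 4 \<Rightarrow> real \<Rightarrow> real \<Rightarrow> (real \<Rightarrow> real) \<Rightarrow> (real \<Rightarrow> real) \<Rightarrow>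
   (real \<Rightarrow> real) \<Rightarrow> (real \<times> real \<Rightarrow> real) \<Rightarrow> real" where
  "entropy_production M_L M_star M_R \<sigma>L \<sigma>R m_L m_R S \<phi> =
     - pairing \<sigma>L \<sigma>R (eta S M_L) (eta S M_star) (eta S M_R)
         (eta_delta S m_L \<sigma>L) (eta_delta S m_R \<sigma>R) (pd_t \<phi>)
     - pairing \<sigma>L \<sigma>R (q S M_L) (q S M_star) (q S M_R)
         (q_delta S m_L \<sigma>L) (q_delta S m_R \<sigma>R) (pd_x \<phi>)"

text \<open>
  The functions \<open>S v = v\<^bsup>2\<alpha>\<^esup>\<close> are written with the natural exponent \<open>k = 2\<alpha>\<close>; in particular
  \<open>\<alpha> = 1/2\<close> is \<open>S v = v\<close> also for negative \<open>v\<close>.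
\<close>

definition measure_solution ::
  "real ^ 4 \<Rightarrow> real ^ 4 \<Rightarrow> real ^ 4 \<Rightarrow> real \<Rightarrow> real \<Rightarrow> (real \<Rightarrow> real) \<Rightarrow> (real \<Rightarrow> real) \<Rightarrow> bool" where
  "measure_solution M_L M_star M_R \<sigma>L \<sigma>R m_L m_R \<longleftrightarrow>
     (\<forall>k\<in>{0, 1, 2, 3}. \<forall>\<phi>. test_function \<phi> \<longrightarrow>
        entropy_production M_L M_star M_R \<sigma>L \<sigma>R m_L m_R (\<lambda>v. v ^ k) \<phi> = 0)"

text \<open>
  An entropic measure solution is in particular a measure solution. The inequalities alone would not
  give the four conservation laws: \<open>v\<close> and \<open>v ^ 3\<close> have no sign, and with all velocities positive,
  \<open>m_L = m_R = 0\<close> and suitable outer states all inequalities hold strictly on both rays.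
\<close>

definition entropic_measure_solution ::
  "real ^ 4 \<Rightarrow> real ^ 4 \<Rightarrow> real ^ 4 \<Rightarrow> real \<Rightarrow> real \<Rightarrow> (real \<Rightarrow> real) \<Rightarrow> (real \<Rightarrow> real) \<Rightarrow> bool" where
  "entropic_measure_solution M_L M_star M_R \<sigma>L \<sigma>R m_L m_R \<longleftrightarrow>
     measure_solution M_L M_star M_R \<sigma>L \<sigma>R m_L m_R \<and>
     (\<forall>k\<in>{0, 1, 2, 3} \<union> {2 * \<alpha> |\<alpha>. \<alpha> \<ge> 2}. \<forall>\<phi>. test_function \<phi> \<and> (\<forall>p. \<phi> p \<ge> 0) \<longrightarrow>
        entropy_production M_L M_star M_R \<sigma>L \<sigma>R m_L m_R (\<lambda>v. v ^ k) \<phi> \<le> 0)"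

definition jump_identities ::
  "real ^ 4 \<Rightarrow> real ^ 4 \<Rightarrow> real ^ 4 \<Rightarrow> real \<Rightarrow> real \<Rightarrow> (real \<Rightarrow> real) \<Rightarrow> (real \<Rightarrow> real) \<Rightarrow> bool" where
  "jump_identities M_L M_star M_R \<sigma>L \<sigma>R m_L m_R \<longleftrightarrow> (\<forall>t\<ge>0.
     t *\<^sub>R \<sigma>L *\<^sub>R (M_L - M_star) - t *\<^sub>R (flux M_L - flux M_star) + M_delta m_L \<sigma>L t = 0 \<and>
     t *\<^sub>R \<sigma>R *\<^sub>R (M_star - M_R) - t *\<^sub>R (flux M_star - flux M_R) + M_delta m_R \<sigma>R t = 0)"

end

theory Submission
  imports Defs
begin

text \<open>
  Up to null sets the sector densities are combinations of indicators of the half planes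
  \<open>x \<le> \<sigma> t\<close>. The divergence theorem there turns the entropy production at a test function \<open>\<phi>\<close> into a
  sum over the two rays of \<open>- \<integral> w \<psi>' dt\<close>, where \<open>\<psi> t = \<phi> (\<sigma> t, t)\<close> and \<open>w\<close> is the left-hand side
  of the jump relation. Testing with functions supported near one ray shows that \<open>w\<close> is nonincreasing
  as a distribution (constant, for equality), and \<open>w 0 = 0\<close>. Conversely, \<open>w \<le> 0\<close> alone would not
  give \<open>w' \<le> 0\<close>, but the first jump identity makes the masses, and hence every \<open>w\<close>, linear in \<open>t\<close>.
\<close>

subsection \<open>Smooth functions of two variables\<close>

text \<open>\<open>pd_x\<close> and \<open>pd_t\<close> are read off from
  \<open>frechet_derivative\<close>, so uniqueness of the derivative identifies them with any
  explicitly given gradient. Smoothness of concrete functions is built up from this rule order by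
  order.\<close>

lemma C_k_SucI:
  assumes d: "\<And>p. (\<phi> has_derivative (\<lambda>h. fx p * fst h + ft p * snd h)) (at p)"
    and "C_k k fx" "C_k k ft"
  shows "C_k (Suc k) \<phi>"
proof -
  have e: "frechet_derivative \<phi> (at p) = (\<lambda>h. fx p * fst h + ft p * snd h)" for p
    using frechet_derivative_at[OF d, of p] by simp
  have "pd_x \<phi> = fx" "pd_t \<phi> = ft"
    by (auto simp: pd_x_def pd_t_def e fun_eq_iff)
  moreover have "\<phi> differentiable_on UNIV"
    using d unfolding differentiable_on_def differentiable_def by auto
  ultimately show ?thesis using assms by simp
qed

lemma C_k_Suc_has_derivative:
  assumes "C_k (Suc k) \<phi>"
  shows "(\<phi> has_derivative (\<lambda>h. pd_x \<phi> p * fst h + pd_t \<phi> p * snd h)) (at p)"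
proof -
  have "\<phi> differentiable at p"
    using assms by (cases p) (auto simp: differentiable_on_def)
  then have d: "(\<phi> has_derivative frechet_derivative \<phi> (at p)) (at p)"
    by (simp add: frechet_derivative_works)
  interpret linear "frechet_derivative \<phi> (at p)"
    using d by (rule has_derivative_linear)
  have "frechet_derivative \<phi> (at p) h = pd_x \<phi> p * fst h + pd_t \<phi> p * snd h" for h
  proof -
    have "h = fst h *\<^sub>R (1, 0) + snd h *\<^sub>R (0, 1)"
      by (simp add: prod_eq_iff)
    then have "frechet_derivative \<phi> (at p) h
        = fst h * frechet_derivative \<phi> (at p) (1, 0) + snd h * frechet_derivative \<phi> (at p) (0, 1)"
      by (metis add scale real_scaleR_def)
    then show ?thesis by (simp add: pd_x_def pd_t_def)
  qed
  then have "frechet_derivative \<phi> (at p) = (\<lambda>h. pd_x \<phi> p * fst h + pd_t \<phi> p * snd h)" by blast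
  with d show ?thesis by simp
qed

lemma C_k_SucD: "C_k (Suc k) \<phi> \<Longrightarrow> C_k k \<phi>"
proof (induction k arbitrary: \<phi>)
  case 0
  then show ?case by (simp add: differentiable_imp_continuous_on)
next
  case (Suc k)
  have "C_k k (pd_x \<phi>)" "C_k k (pd_t \<phi>)"
    by (rule Suc.IH, use Suc.prems in simp)+
  then show ?case using Suc.prems by auto
qed

lemma C_k_add: "C_k k f \<Longrightarrow> C_k k g \<Longrightarrow> C_k k (\<lambda>p. f p + g p)"
proof (induction k arbitrary: f g)
  case 0
  then show ?case by (auto intro: continuous_intros)
next
  case (Suc k)
  show ?case
  proof (rule C_k_SucI)
    show "((\<lambda>p. f p + g p) has_derivative
        (\<lambda>h. (pd_x f p + pd_x g p) * fst h + (pd_t f p + pd_t g p) * snd h)) (at p)" for p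
      by (rule has_derivative_eq_rhs[OF has_derivative_add[OF
            Suc.prems[THEN C_k_Suc_has_derivative]]]) (auto simp: algebra_simps)
  qed (use Suc in auto)
qed

lemma C_k_mult: "C_k k f \<Longrightarrow> C_k k g \<Longrightarrow> C_k k (\<lambda>p. f p * g p)"
proof (induction k arbitrary: f g)
  case 0
  then show ?case by (auto intro: continuous_intros)
next
  case (Suc k)
  show ?case
  proof (rule C_k_SucI)
    show "((\<lambda>p. f p * g p) has_derivative
        (\<lambda>h. (f p * pd_x g p + pd_x f p * g p) * fst h + (f p * pd_t g p + pd_t f p * g p) * snd h)) (at p)" for p
      by (rule has_derivative_eq_rhs[OF has_derivative_mult[OF
            Suc.prems[THEN C_k_Suc_has_derivative]]]) (auto simp: algebra_simps)
    \<comment> \<open>The product rule leaves one factor undifferentiated in each term, so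
      \<open>f\<close> and \<open>g\<close> themselves are also needed at order \<open>k\<close>,
      one below the hypothesis.\<close>
    have "C_k k f" "C_k k g" "C_k k (pd_x f)" "C_k k (pd_x g)" "C_k k (pd_t f)" "C_k k (pd_t g)"
      using Suc.prems C_k_SucD[OF Suc.prems(1)] C_k_SucD[OF Suc.prems(2)] by simp_all
    then show "C_k k (\<lambda>p. f p * pd_x g p + pd_x f p * g p)"
      and "C_k k (\<lambda>p. f p * pd_t g p + pd_t f p * g p)"
      by (auto intro!: C_k_add Suc.IH)
  qed
qed

lemma C_k_const: "C_k k (\<lambda>p. c)"
proof (induction k arbitrary: c)
  case (Suc k)
  show ?case
    by (rule C_k_SucI[where fx = "\<lambda>p. 0" and ft = "\<lambda>p. 0"]) (use Suc in auto)
qed auto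

section \<open>A smooth function vanishing exactly on the left half line\<close>

primrec flat_poly :: "nat \<Rightarrow> real poly" where
  "flat_poly 0 = 1"
| "flat_poly (Suc n) = [:0, 0, 1:] * (flat_poly n - pderiv (flat_poly n))"

text \<open>\<open>flat n\<close> is the \<open>n\<close>-th derivative of \<open>exp (- 1 / x)\<close>, extended by 0 to \<open>x \<le> 0\<close>.\<close>

definition flat :: "nat \<Rightarrow> real \<Rightarrow> real" where
  "flat n x = (if x > 0 then poly (flat_poly n) (1 / x) * exp (- (1 / x)) else 0)"

text \<open>Exponential decay beats every polynomial. The free power \<open>y ^ k\<close> carries
  the induction: it absorbs the factor \<open>y\<close> that \<open>pCons\<close> puts in front of
  \<open>poly p y\<close>.\<close>

lemma poly_mult_exp_neg_tendsto_0: "((\<lambda>y::real. y ^ k * poly p y * exp (- y)) \<longlongrightarrow> 0) at_top"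
proof (induction p arbitrary: k)
  case 0
  then show ?case by simp
next
  case (pCons a p)
  have "((\<lambda>y. a * (y ^ k / exp y) + y ^ Suc k * poly p y * exp (- y)) \<longlongrightarrow> a * 0 + 0) at_top"
    by (intro tendsto_intros tendsto_power_div_exp_0 pCons.IH)
  then show ?case
    by (simp add: algebra_simps exp_minus divide_inverse)
qed

text \<open>For \<open>x > 0\<close> and \<open>y = 1 / x\<close>, the derivative of
  \<open>P(y) * exp (- y)\<close> in \<open>x\<close> is
  \<open>y^2 * (P(y) - P'(y)) * exp (- y)\<close>, which is the recursion of
  \<open>flat_poly\<close>. At the origin the right difference quotient is
  \<open>y * P(y) * exp (- y)\<close> with \<open>y\<close> tending to infinity.\<close>

lemma flat_has_derivative: "(flat n has_real_derivative flat (Suc n) x) (at x)"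
proof (cases x "0::real" rule: linorder_cases)
  case less
  have "((\<lambda>x. 0) has_real_derivative flat (Suc n) x) (at x)"
    using less by (simp add: flat_def)
  then show ?thesis
    by (rule DERIV_cong_ev[THEN iffD1, rotated -1])
      (use less in \<open>auto simp: flat_def intro: eventually_mono[OF eventually_nhds_in_open[of "{..<0}"]]\<close>)
next
  case greater
  have "((\<lambda>x. poly (flat_poly n) (1 / x) * exp (- (1 / x))) has_real_derivative flat (Suc n) x) (at x)"
    using greater by (auto intro!: derivative_eq_intros simp: flat_def field_simps power2_eq_square)
  then show ?thesis
    by (rule DERIV_cong_ev[THEN iffD1, rotated -1])
      (use greater in \<open>auto simp: flat_def intro: eventually_mono[OF eventually_nhds_in_open[of "{0<..}"]]\<close>)
next
  case equal
  have "((\<lambda>h. flat n h / h) \<longlongrightarrow> 0) (at_right 0)"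
  proof -
    have "((\<lambda>h. inverse h ^ 1 * poly (flat_poly n) (inverse h) * exp (- inverse h)) \<longlongrightarrow> 0) (at_right 0)"
      by (rule filterlim_compose[OF poly_mult_exp_neg_tendsto_0 filterlim_inverse_at_top_right])
    then show ?thesis
      by (rule Lim_transform_eventually)
        (auto simp: eventually_at_filter flat_def field_simps)
  qed
  moreover have "((\<lambda>h. flat n h / h) \<longlongrightarrow> 0) (at_left 0)"
    by (rule Lim_transform_eventually[of "\<lambda>_. 0"])
        (auto simp: eventually_at_filter flat_def)
  ultimately have "((\<lambda>h. flat n h / h) \<longlongrightarrow> 0) (at 0)"
    by (simp add: filterlim_split_at)
  then show ?thesis using equal by (simp add: DERIV_def flat_def)
qed

lemma flat_0_nonneg: "flat 0 x \<ge> 0" and flat_0_pos_iff: "flat 0 x > 0 \<longleftrightarrow> x > 0"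
  and flat_0_eq_0_iff: "flat 0 x = 0 \<longleftrightarrow> x \<le> 0"
  by (auto simp: flat_def)

text \<open>Differentiation raises \<open>n\<close> by one and pulls out \<open>a\<close> or
  \<open>b\<close>; with \<open>c\<close> and \<open>n\<close> arbitrary, the family is closed under
  both partial derivatives.\<close>

lemma C_k_flat_affine: "C_k k (\<lambda>p. c * flat n (a * fst p + b * snd p + d))"
proof (induction k arbitrary: c n)
  case 0
  have "continuous_on UNIV (flat n)"
    using flat_has_derivative by (meson DERIV_isCont continuous_at_imp_continuous_on)
  then show ?case
    by (auto intro!: continuous_on_mult_const continuous_on_compose2[of UNIV "flat n"] continuous_on_add
        continuous_on_fst continuous_on_snd continuous_on_const continuous_on_id continuous_on_mult)
next
  case (Suc k)
  show ?case
  proof (rule C_k_SucI)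
    fix p :: "real \<times> real"
    have "((\<lambda>p. a * fst p + b * snd p + d) has_derivative (\<lambda>h. a * fst h + b * snd h)) (at p)"
      by (auto intro!: derivative_eq_intros)
    from has_derivative_compose[OF this has_field_derivative_imp_has_derivative[OF flat_has_derivative]]
    show "((\<lambda>p. c * flat n (a * fst p + b * snd p + d)) has_derivative
        (\<lambda>h. (c * a * flat (Suc n) (a * fst p + b * snd p + d)) * fst h
           + (c * b * flat (Suc n) (a * fst p + b * snd p + d)) * snd h)) (at p)"
      by (rule has_derivative_eq_rhs[OF has_derivative_mult_right]) (auto simp: algebra_simps)
  qed (rule Suc)+
qed

subsection \<open>Integrals over half planes\<close>

lemma integrable_bounded_support:
  fixes f :: "'a::euclidean_space \<Rightarrow> real"
  assumes "continuous_on UNIV f" "bounded {x. f x \<noteq> 0}"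
  shows "integrable lborel f"
proof -
  have "integrable lborel (\<lambda>x. indicator (closure {x. f x \<noteq> 0}) x *\<^sub>R f x)"
    using assms by (intro borel_integrable_compact)
      (auto simp: compact_closure intro: continuous_on_subset)
  moreover have "indicator (closure {x. f x \<noteq> 0}) x *\<^sub>R f x = f x" for x
    using closure_subset[of "{x. f x \<noteq> 0}"] by (auto simp: indicator_def)
  ultimately show ?thesis by (simp only:)
qed

section \<open>Integrals of derivatives of functions with bounded support\<close>

lemma integral_deriv_atMost:
  fixes g :: "real \<Rightarrow> real"
  assumes d: "\<And>x. (g has_real_derivative g' x) (at x)" and cont: "continuous_on UNIV g'"
    and bnd: "bounded {x. g x \<noteq> 0}"
  shows "(LINT x|lborel. indicator {..c} x * g' x) = g c"
proof -
  obtain B where B: "\<And>x. g x \<noteq> 0 \<Longrightarrow> \<bar>x\<bar> \<le> B"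
    using bnd by (auto simp: bounded_iff)
  \<comment> \<open>To the left of \<open>- B\<close> both \<open>g\<close> and its derivative
    vanish, so the half line can be cut off at \<open>a\<close>. The minimum keeps
    \<open>a \<le> c\<close> even when \<open>c\<close> lies beyond the support.\<close>
  define a where "a = min c (- B - 1)"
  have g0: "g x = 0" if "x < - B" for x
    using B[of x] that by (cases "g x = 0") auto
  have g'0: "g' x = 0" if "x < - B" for x
  proof -
    have "((\<lambda>x. 0) has_real_derivative g' x) (at x)"
      by (rule has_field_derivative_transform_within_open[OF d, of "{..< - B}"]) (use that g0 in auto)
    then show ?thesis using DERIV_const DERIV_unique by blast
  qed
  have "(LINT x|lborel. indicator {..c} x * g' x) = (LINT x|lborel. indicator {a..c} x *\<^sub>R g' x)"
    by (rule Bochner_Integration.integral_cong) (use g'0 in \<open>auto simp: indicator_def a_def\<close>)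
  also have "\<dots> = g c - g a"
    by (rule integral_FTC_atLeastAtMost)
      (use d cont in \<open>auto simp: a_def has_real_derivative_iff_has_vector_derivative
        intro: has_vector_derivative_at_within continuous_on_subset\<close>)
  also have "g a = 0"
    using g0 by (simp add: a_def)
  finally show ?thesis by simp
qed

lemma integral_deriv_eq_0:
  fixes g :: "real \<Rightarrow> real"
  assumes d: "\<And>x. (g has_real_derivative g' x) (at x)" and cont: "continuous_on UNIV g'"
    and bnd: "bounded {x. g x \<noteq> 0}"
  shows "(LINT x|lborel. g' x) = 0"
proof -
  obtain B where B: "\<And>x. g x \<noteq> 0 \<Longrightarrow> \<bar>x\<bar> \<le> B"
    using bnd by (auto simp: bounded_iff)
  have g0: "g x = 0" if "x > B" for x
    using B[of x] that by (cases "g x = 0") auto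
  have g'0: "g' x = 0" if "x > B" for x
  proof -
    have "((\<lambda>x. 0) has_real_derivative g' x) (at x)"
      by (rule has_field_derivative_transform_within_open[OF d, of "{B<..}"]) (use that g0 in auto)
    then show ?thesis using DERIV_const DERIV_unique by blast
  qed
  have "(LINT x|lborel. g' x) = (LINT x|lborel. indicator {..B + 1} x * g' x)"
    by (rule Bochner_Integration.integral_cong) (use g'0 in \<open>auto simp: indicator_def\<close>)
  also have "\<dots> = 0"
    using integral_deriv_atMost[OF assms, of "B + 1"] g0 by simp
  finally show ?thesis .
qed

lemma LINT_plane_snd:
  fixes f :: "real \<times> real \<Rightarrow> real"
  assumes "integrable lborel f"
  shows "(LINT p|lborel. f p) = (LINT t|lborel. LINT x|lborel. f (x, t))"
  using lborel_pair.integral_snd[of "\<lambda>x t. f (x, t)"] assms by (simp add: lborel_prod)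

lemma LINT_plane_fst:
  fixes f :: "real \<times> real \<Rightarrow> real"
  assumes "integrable lborel f"
  shows "(LINT p|lborel. f p) = (LINT x|lborel. LINT t|lborel. f (x, t))"
  using lborel_pair.integral_fst'[of f] assms by (simp add: lborel_prod)

definition half_plane :: "real \<Rightarrow> (real \<times> real) set" where
  "half_plane \<sigma> = {(x, t). x \<le> \<sigma> * t}"

lemma half_plane_measurable [measurable]: "half_plane \<sigma> \<in> sets borel"
proof -
  have "closed (half_plane \<sigma>)"
    unfolding half_plane_def case_prod_beta by (intro closed_Collect_le continuous_intros)
  then show ?thesis by simp
qed

lemma integrable_half_plane:
  fixes f :: "real \<times> real \<Rightarrow> real"
  assumes "integrable lborel f"
  shows "integrable lborel (\<lambda>p. indicator (half_plane \<sigma>) p * f p)"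
  using integrable_mult_indicator[of "half_plane \<sigma>" lborel f] assms by simp

text \<open>The support of the sheared function is the image of the support under the inverse shear,
  a bounded linear map. The slices are contained in coordinate projections of the support.\<close>

lemma bounded_support_slices:
  fixes f :: "real \<times> real \<Rightarrow> real" and \<sigma> :: real
  assumes "bounded {p. f p \<noteq> 0}"
  shows "bounded {p. f (fst p + \<sigma> * snd p, snd p) \<noteq> 0}"
    and "bounded {t. f (\<sigma> * t, t) \<noteq> 0}" and "bounded {x. f (x, s) \<noteq> 0}"
    and "bounded {t. f (x, t) \<noteq> 0}"
proof -
  have "bounded ((\<lambda>p. (fst p - \<sigma> * snd p, snd p)) ` {p. f p \<noteq> 0})"
    by (intro bounded_linear_image[OF assms] bounded_linear_intros)
  then show "bounded {p. f (fst p + \<sigma> * snd p, snd p) \<noteq> 0}"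
    by (rule bounded_subset) (force simp: image_iff)
  have bx: "bounded (fst ` {p. f p \<noteq> 0})" and bt: "bounded (snd ` {p. f p \<noteq> 0})"
    using assms by (auto intro: bounded_fst bounded_snd)
  show "bounded {t. f (\<sigma> * t, t) \<noteq> 0}" "bounded {t. f (x, t) \<noteq> 0}"
    by (rule bounded_subset[OF bt]; force)+
  show "bounded {x. f (x, s) \<noteq> 0}"
    by (rule bounded_subset[OF bx]) force
qed

text \<open>The shear \<open>(x, t) \<mapsto> (x - \<sigma> t, t)\<close> straightens the ray to the vertical axis.\<close>

lemma LINT_half_plane_shear:
  fixes f :: "real \<times> real \<Rightarrow> real"
  assumes cont: "continuous_on UNIV f" and bnd: "bounded {p. f p \<noteq> 0}"
  shows "(LINT p|lborel. indicator (half_plane \<sigma>) p * f p)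
       = (LINT y|lborel. indicator {..0} y * (LINT t|lborel. f (y + \<sigma> * t, t)))"
proof -
  define g where "g = (\<lambda>p. f (fst p + \<sigma> * snd p, snd p))"
  have g: "integrable lborel g"
    unfolding g_def using bounded_support_slices(1)[OF bnd]
    by (intro integrable_bounded_support)
      (auto intro!: continuous_on_compose2[OF cont] continuous_intros)
  have "(LINT p|lborel. indicator (half_plane \<sigma>) p * f p)
      = (LINT t|lborel. LINT x|lborel. indicator (half_plane \<sigma>) (x, t) * f (x, t))"
    using integrable_half_plane[OF integrable_bounded_support[OF cont bnd]] by (rule LINT_plane_snd)
  \<comment> \<open>For fixed \<open>t\<close> the shear is a translation by
    \<open>\<sigma> * t\<close>, so translation invariance on the real line suffices; swapping the
    order of integration afterwards gives the claim.\<close>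
  also have "\<dots> = (LINT t|lborel. LINT y|lborel. indicator (half_plane 0) (y, t) * g (y, t))"
  proof (rule Bochner_Integration.integral_cong[OF refl])
    fix t :: real
    show "(LINT x|lborel. indicator (half_plane \<sigma>) (x, t) * f (x, t))
        = (LINT y|lborel. indicator (half_plane 0) (y, t) * g (y, t))"
      by (subst lborel_integral_real_affine[where c = 1 and t = "\<sigma> * t"])
        (auto intro!: Bochner_Integration.integral_cong simp: g_def half_plane_def indicator_def add.commute)
  qed
  also have "\<dots> = (LINT p|lborel. indicator (half_plane 0) p * g p)"
    using integrable_half_plane[OF g] by (rule LINT_plane_snd[symmetric])
  also have "\<dots> = (LINT y|lborel. LINT t|lborel. indicator (half_plane 0) (y, t) * g (y, t))"
    using integrable_half_plane[OF g] by (rule LINT_plane_fst)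
  also have "\<dots> = (LINT y|lborel. indicator {..0} y * (LINT t|lborel. f (y + \<sigma> * t, t)))"
    by (intro Bochner_Integration.integral_cong) (auto simp: g_def half_plane_def indicator_def)
  finally show ?thesis .
qed

text \<open>Chain rule along a straight line. It is used in the directions \<open>(1, 0)\<close>,
  \<open>(0, 1)\<close> and \<open>(\<sigma>, 1)\<close>, the last being that of a ray.\<close>

lemma deriv_along_line:
  assumes "\<And>p. (\<phi> has_derivative (\<lambda>h. fx p * fst h + ft p * snd h)) (at p)"
  shows "((\<lambda>s. \<phi> (x + a * s, y + b * s)) has_real_derivative
     a * fx (x + a * s, y + b * s) + b * ft (x + a * s, y + b * s)) (at s)"
proof -
  have "((\<lambda>s. (x + a * s, y + b * s)) has_derivative (\<lambda>h. (a * h, b * h))) (at s)"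
    by (auto intro!: derivative_eq_intros)
  from has_derivative_compose[OF this assms] show ?thesis
    unfolding has_field_derivative_def
    by (rule has_derivative_eq_rhs) (auto simp: algebra_simps)
qed

section \<open>The divergence theorem on half planes\<close>

context
  fixes \<phi> fx ft :: "real \<times> real \<Rightarrow> real"
  assumes deriv: "\<And>p. (\<phi> has_derivative (\<lambda>h. fx p * fst h + ft p * snd h)) (at p)"
    and cont: "continuous_on UNIV fx" "continuous_on UNIV ft"
    and bnd: "bounded {p. \<phi> p \<noteq> 0}" "bounded {p. fx p \<noteq> 0}" "bounded {p. ft p \<noteq> 0}"
begin

text \<open>Integrating in \<open>x\<close> first, each horizontal line is cut at
  \<open>x = \<sigma> * t\<close>, and the fundamental theorem leaves the value of
  \<open>\<phi>\<close> there.\<close>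

lemma LINT_half_plane_fx:
  "(LINT p|lborel. indicator (half_plane \<sigma>) p * fx p) = (LINT t|lborel. \<phi> (\<sigma> * t, t))"
proof -
  have "(LINT p|lborel. indicator (half_plane \<sigma>) p * fx p)
      = (LINT t|lborel. LINT x|lborel. indicator (half_plane \<sigma>) (x, t) * fx (x, t))"
    using integrable_half_plane[OF integrable_bounded_support[OF cont(1) bnd(2)]] by (rule LINT_plane_snd)
  also have "(\<lambda>t. LINT x|lborel. indicator (half_plane \<sigma>) (x, t) * fx (x, t)) = (\<lambda>t. \<phi> (\<sigma> * t, t))"
  proof
    fix t
    have "(LINT x|lborel. indicator {..\<sigma> * t} x * fx (x, t)) = \<phi> (\<sigma> * t, t)"
      by (rule integral_deriv_atMost)
        (use deriv_along_line[OF deriv, of 0 1 t 0] bounded_support_slices(3)[OF bnd(1)] in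
         \<open>auto intro!: continuous_on_compose2[OF cont(1)] continuous_intros\<close>)
    then show "(LINT x|lborel. indicator (half_plane \<sigma>) (x, t) * fx (x, t)) = \<phi> (\<sigma> * t, t)"
      by (simp add: half_plane_def indicator_def)
  qed
  finally show ?thesis .
qed

text \<open>The combination \<open>\<sigma> * fx + ft\<close> is the derivative parallel to the
  boundary line, so it integrates to 0 along every parallel and hence over the half plane. This
  reduces \<open>ft\<close> to \<open>fx\<close>.\<close>

lemma LINT_half_plane_ft:
  "(LINT p|lborel. indicator (half_plane \<sigma>) p * ft p) = - \<sigma> * (LINT t|lborel. \<phi> (\<sigma> * t, t))"
proof -
  let ?f = "\<lambda>p. \<sigma> * fx p + ft p"
  have cf: "continuous_on UNIV ?f"
    using cont by (intro continuous_intros)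
  have bf: "bounded {p. ?f p \<noteq> 0}"
    by (rule bounded_subset[OF bounded_Un[THEN iffD2, OF conjI[OF bnd(2,3)]]]) auto
  have "(LINT t|lborel. ?f (y + \<sigma> * t, t)) = 0" for y
    by (rule integral_deriv_eq_0[where g = "\<lambda>t. \<phi> (y + \<sigma> * t, t)"])
      (use deriv_along_line[OF deriv, of y \<sigma> 0 1] bounded_support_slices(1)[OF bnd(1), of \<sigma>] in
       \<open>auto intro!: continuous_on_compose2[OF cont(1)] continuous_on_compose2[OF cont(2)] continuous_intros
          dest: bounded_support_slices(4)[where x = y]\<close>)
  then have "(LINT p|lborel. indicator (half_plane \<sigma>) p * ?f p) = 0"
    using LINT_half_plane_shear[OF cf bf] by simp
  moreover have "(LINT p|lborel. indicator (half_plane \<sigma>) p * ?f p)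
      = \<sigma> * (LINT p|lborel. indicator (half_plane \<sigma>) p * fx p)
        + (LINT p|lborel. indicator (half_plane \<sigma>) p * ft p)"
    using integrable_half_plane[OF integrable_bounded_support[OF cont(1) bnd(2)], of \<sigma>]
      integrable_half_plane[OF integrable_bounded_support[OF cont(2) bnd(3)], of \<sigma>]
    by (simp add: distrib_left mult.left_commute)
  ultimately show ?thesis by (simp add: LINT_half_plane_fx)
qed

lemma LINT_plane_fx: "(LINT p|lborel. fx p) = 0"
proof -
  have "(LINT x|lborel. fx (x, t)) = 0" for t
    by (rule integral_deriv_eq_0)
      (use deriv_along_line[OF deriv, of 0 1 t 0] bounded_support_slices(3)[OF bnd(1)] in
       \<open>auto intro!: continuous_on_compose2[OF cont(1)] continuous_intros\<close>)
  then show ?thesis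
    by (simp add: LINT_plane_snd[OF integrable_bounded_support[OF cont(1) bnd(2)]])
qed

lemma LINT_plane_ft: "(LINT p|lborel. ft p) = 0"
proof -
  have "(LINT t|lborel. ft (x, t)) = 0" for x
    by (rule integral_deriv_eq_0)
      (use deriv_along_line[OF deriv, of x 0 0 1] bounded_support_slices(4)[OF bnd(1)] in
       \<open>auto intro!: continuous_on_compose2[OF cont(2)] continuous_intros\<close>)
  then show ?thesis
    by (simp add: LINT_plane_fst[OF integrable_bounded_support[OF cont(2) bnd(3)]])
qed

end

text \<open>For \<open>t > 0\<close> the two half planes are nested, so off the rays the density is
  a telescoping combination of their indicators and a constant. For \<open>t < 0\<close> the nesting
  is reversed, but \<open>\<psi>\<close> vanishes there.\<close>

lemma sector_integral:
  assumes cont: "continuous_on UNIV \<psi>" and bnd: "bounded {p. \<psi> p \<noteq> 0}"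
    and pos: "\<And>x t. t \<le> 0 \<Longrightarrow> \<psi> (x, t) = 0" and "\<sigma>L < \<sigma>R"
  shows "(LINT p:UNIV \<times> {0<..}|lborel. sector_density \<sigma>L \<sigma>R uL uS uR p * \<psi> p)
       = (uL - uS) * (LINT p|lborel. indicator (half_plane \<sigma>L) p * \<psi> p)
         + (uS - uR) * (LINT p|lborel. indicator (half_plane \<sigma>R) p * \<psi> p)
         + uR * (LINT p|lborel. \<psi> p)"
proof -
  have [measurable]: "\<psi> \<in> borel_measurable borel"
    using cont by (rule borel_measurable_continuous_onI)
  have [measurable]: "fst \<in> borel_measurable (borel :: (real \<times> real) measure)"
    "snd \<in> borel_measurable (borel :: (real \<times> real) measure)"
    by (intro borel_measurable_continuous_onI continuous_intros)+
  have [measurable]: "sector_density \<sigma>L \<sigma>R uL uS uR \<in> borel_measurable borel"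
    unfolding sector_density_def case_prod_beta by measurable
  have [measurable]: "UNIV \<times> {0<..} \<in> sets (borel :: (real \<times> real) measure)"
    by (intro borel_open open_Times) auto
  have int: "integrable lborel (\<lambda>p. indicator (half_plane \<sigma>) p * \<psi> p)" "integrable lborel \<psi>" for \<sigma>
    using integrable_half_plane[OF integrable_bounded_support[OF cont bnd]]
      integrable_bounded_support[OF cont bnd] by auto
  \<comment> \<open>A ray lies on a line through the origin, which is a hyperplane of the plane and
    therefore a null set.\<close>
  have ray: "AE p in lborel. fst p \<noteq> \<sigma> * snd p" for \<sigma> :: real
  proof -
    have cl: "closed {p :: real \<times> real. (1, - \<sigma>) \<bullet> p = 0}"
      by (rule closed_hyperplane)
    have "negligible {p :: real \<times> real. (1, - \<sigma>) \<bullet> p = 0}"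
      by (rule negligible_hyperplane) (simp add: zero_prod_def)
    then have "{p :: real \<times> real. (1, - \<sigma>) \<bullet> p = 0} \<in> null_sets lborel"
      using cl by (simp add: negligible_iff_null_sets null_sets_completion_iff)
    from AE_not_in[OF this] show ?thesis
      by eventually_elim (auto simp: inner_prod_def)
  qed
  let ?g = "\<lambda>p. (uL - uS) * (indicator (half_plane \<sigma>L) p * \<psi> p)
      + (uS - uR) * (indicator (half_plane \<sigma>R) p * \<psi> p) + uR * \<psi> p"
  have "(LINT p:UNIV \<times> {0<..}|lborel. sector_density \<sigma>L \<sigma>R uL uS uR p * \<psi> p) = (LINT p|lborel. ?g p)"
    unfolding set_lebesgue_integral_def
  proof (rule integral_cong_AE)
    show "AE p in lborel. indicator (UNIV \<times> {0<..}) p *\<^sub>R (sector_density \<sigma>L \<sigma>R uL uS uR p * \<psi> p) = ?g p"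
      using ray[of \<sigma>L] ray[of \<sigma>R]
    proof eventually_elim
      fix p :: "real \<times> real"
      assume p: "fst p \<noteq> \<sigma>L * snd p" "fst p \<noteq> \<sigma>R * snd p"
      obtain x t where xt: "p = (x, t)" by (cases p)
      show "indicator (UNIV \<times> {0<..}) p *\<^sub>R (sector_density \<sigma>L \<sigma>R uL uS uR p * \<psi> p) = ?g p"
      proof (cases "t \<le> 0")
        case False
        then have "\<sigma>L * t < \<sigma>R * t" using \<open>\<sigma>L < \<sigma>R\<close> by simp
        then have "x \<le> \<sigma>L * t \<Longrightarrow> x < \<sigma>R * t" by linarith
        then show ?thesis using False p
          by (auto simp: xt sector_density_def half_plane_def indicator_def algebra_simps)
      qed (simp add: xt pos)
    qed
  qed measurable
  then show ?thesis using int by simp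
qed

lemma test_functionD:
  assumes "test_function \<phi>"
  shows test_function_has_derivative:
      "(\<phi> has_derivative (\<lambda>h. pd_x \<phi> p * fst h + pd_t \<phi> p * snd h)) (at p)"
    and test_function_continuous:
      "continuous_on UNIV \<phi>" "continuous_on UNIV (pd_x \<phi>)" "continuous_on UNIV (pd_t \<phi>)"
    and test_function_bounded:
      "bounded {p. \<phi> p \<noteq> 0}" "bounded {p. pd_x \<phi> p \<noteq> 0}" "bounded {p. pd_t \<phi> p \<noteq> 0}"
    and test_function_eq_0:
      "t \<le> 0 \<Longrightarrow> \<phi> (x, t) = 0" "t \<le> 0 \<Longrightarrow> pd_x \<phi> (x, t) = 0" "t \<le> 0 \<Longrightarrow> pd_t \<phi> (x, t) = 0"
proof -
  define K where "K = closure {p. \<phi> p \<noteq> 0}"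
  have C: "C_k (Suc k) \<phi>" for k
    using assms unfolding test_function_def by blast
  show d: "(\<phi> has_derivative (\<lambda>h. pd_x \<phi> p * fst h + pd_t \<phi> p * snd h)) (at p)" for p
    using C by (rule C_k_Suc_has_derivative)
  show "continuous_on UNIV \<phi>" "continuous_on UNIV (pd_x \<phi>)" "continuous_on UNIV (pd_t \<phi>)"
    using C[of 0] by (auto intro: differentiable_imp_continuous_on)
  have cl: "closed K" and K: "bounded K" "K \<subseteq> UNIV \<times> {0<..}"
    using assms by (auto simp: test_function_def K_def dest: compact_imp_bounded)
  have z: "\<phi> p = 0" if "p \<notin> K" for p
    using that closure_subset[of "{p. \<phi> p \<noteq> 0}"] unfolding K_def by blast
  \<comment> \<open>The complement of \<open>K\<close> is open, so \<open>\<phi>\<close> vanishes in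
    a neighbourhood of such a point and its gradient is 0.\<close>
  have pd: "pd_x \<phi> p = 0 \<and> pd_t \<phi> p = 0" if "p \<notin> K" for p
  proof -
    have "((\<lambda>p. 0) has_derivative (\<lambda>h. pd_x \<phi> p * fst h + pd_t \<phi> p * snd h)) (at p)"
      by (rule has_derivative_transform_within_open[OF d, of "- K"]) (use cl that z in auto)
    then have "(\<lambda>h. pd_x \<phi> p * fst h + pd_t \<phi> p * snd h) = (\<lambda>h. 0)"
      by (rule has_derivative_unique) (rule has_derivative_const)
    from fun_cong[OF this, of "(1, 0)"] fun_cong[OF this, of "(0, 1)"] show ?thesis by simp
  qed
  show "bounded {p. \<phi> p \<noteq> 0}" "bounded {p. pd_x \<phi> p \<noteq> 0}" "bounded {p. pd_t \<phi> p \<noteq> 0}"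
    by (rule bounded_subset[OF K(1)], use z pd in blast)+
  have "(x, t) \<notin> K" if "t \<le> 0" for x t
    using K(2) that by auto
  then show "t \<le> 0 \<Longrightarrow> \<phi> (x, t) = 0" "t \<le> 0 \<Longrightarrow> pd_x \<phi> (x, t) = 0" "t \<le> 0 \<Longrightarrow> pd_t \<phi> (x, t) = 0"
    using z pd by blast+
qed

subsection \<open>Entropy production on the rays\<close>

definition ray_deriv :: "real \<Rightarrow> (real \<times> real \<Rightarrow> real) \<Rightarrow> real \<Rightarrow> real" where
  "ray_deriv \<sigma> \<phi> t = \<sigma> * pd_x \<phi> (\<sigma> * t, t) + pd_t \<phi> (\<sigma> * t, t)"

text \<open>Since \<open>f\<close> vanishes for \<open>t \<le> 0\<close> and beyond some
  \<open>B\<close>, the integrand lives on \<open>{0..B}\<close>, where continuity of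
  \<open>w\<close> on \<open>{0..}\<close> is enough.\<close>

lemma set_integrable_half_line:
  fixes f w :: "real \<Rightarrow> real"
  assumes w: "continuous_on {0..} w" and f: "continuous_on UNIV f" "bounded {t. f t \<noteq> 0}"
    and pos: "\<And>t. t \<le> 0 \<Longrightarrow> f t = 0"
  shows "set_integrable lborel {0<..} (\<lambda>t. w t * f t)"
proof -
  obtain B where B: "\<And>t. f t \<noteq> 0 \<Longrightarrow> \<bar>t\<bar> \<le> B"
    using f(2) by (auto simp: bounded_iff)
  have "integrable lborel (\<lambda>t. indicator {0..B} t *\<^sub>R (w t * f t))"
    using w f by (intro borel_integrable_compact) (auto intro!: continuous_intros intro: continuous_on_subset)
  also have "(\<lambda>t. indicator {0..B} t *\<^sub>R (w t * f t)) = (\<lambda>t. indicator {0<..} t *\<^sub>R (w t * f t))"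
  proof
    fix t show "indicator {0..B} t *\<^sub>R (w t * f t) = indicator {0<..} t *\<^sub>R (w t * f t)"
      using B[of t] pos[of t] by (cases "f t = 0") (auto simp: indicator_def)
  qed
  finally show ?thesis unfolding set_integrable_def .
qed

lemma ray_deriv_props:
  assumes "test_function \<phi>"
  shows ray_has_derivative: "((\<lambda>t. \<phi> (\<sigma> * t, t)) has_real_derivative ray_deriv \<sigma> \<phi> t) (at t)"
    and ray_deriv_continuous: "continuous_on UNIV (ray_deriv \<sigma> \<phi>)"
    and ray_deriv_bounded: "bounded {t. ray_deriv \<sigma> \<phi> t \<noteq> 0}"
    and ray_deriv_eq_0: "t \<le> 0 \<Longrightarrow> ray_deriv \<sigma> \<phi> t = 0"
proof -
  note D = test_functionD[OF assms]
  show "((\<lambda>t. \<phi> (\<sigma> * t, t)) has_real_derivative ray_deriv \<sigma> \<phi> t) (at t)"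
    using deriv_along_line[OF D(1), of 0 \<sigma> 0 1] by (simp add: ray_deriv_def)
  show "continuous_on UNIV (ray_deriv \<sigma> \<phi>)"
    unfolding ray_deriv_def
    by (auto intro!: continuous_on_compose2[OF D(3)] continuous_on_compose2[OF D(4)] continuous_intros)
  have "bounded ({t. pd_x \<phi> (\<sigma> * t, t) \<noteq> 0} \<union> {t. pd_t \<phi> (\<sigma> * t, t) \<noteq> 0})"
    using bounded_support_slices(2) D(6,7) by simp
  then show "bounded {t. ray_deriv \<sigma> \<phi> t \<noteq> 0}"
    by (rule bounded_subset) (auto simp: ray_deriv_def)
  show "t \<le> 0 \<Longrightarrow> ray_deriv \<sigma> \<phi> t = 0"
    using D(9,10) by (simp add: ray_deriv_def)
qed

text \<open>The derivative of \<open>t * \<phi> (\<sigma> * t, t)\<close> integrates to 0. This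
  brings the boundary terms of the sectors into the form of the singular parts, paired with
  \<open>ray_deriv\<close> with weight \<open>t\<close>.\<close>

lemma ray_integral_by_parts:
  assumes "test_function \<phi>"
  shows "(LINT t|lborel. \<phi> (\<sigma> * t, t)) = - (LINT t:{0<..}|lborel. t * ray_deriv \<sigma> \<phi> t)"
proof -
  note D = test_functionD[OF assms] and R = ray_deriv_props[OF assms, where \<sigma> = \<sigma>]
  have c: "continuous_on UNIV (\<lambda>t. \<phi> (\<sigma> * t, t))"
    by (auto intro!: continuous_on_compose2[OF D(2)] continuous_intros)
  have b: "bounded {t. \<phi> (\<sigma> * t, t) \<noteq> 0}"
    using bounded_support_slices(2) D(5) by simp
  have d: "((\<lambda>t. t * \<phi> (\<sigma> * t, t)) has_real_derivative t * ray_deriv \<sigma> \<phi> t + \<phi> (\<sigma> * t, t)) (at t)" for t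
    by (rule DERIV_cong[OF DERIV_mult[OF DERIV_ident R(1)]]) simp
  have "(LINT t|lborel. t * ray_deriv \<sigma> \<phi> t + \<phi> (\<sigma> * t, t)) = 0"
    by (rule integral_deriv_eq_0[OF d])
      (auto intro!: continuous_intros R(2) c intro: bounded_subset[OF b])
  moreover have "integrable lborel (\<lambda>t. t * ray_deriv \<sigma> \<phi> t)"
    by (rule integrable_bounded_support)
      (auto intro!: continuous_intros R(2) intro: bounded_subset[OF R(3)])
  moreover have "(LINT t:{0<..}|lborel. t * ray_deriv \<sigma> \<phi> t) = (LINT t|lborel. t * ray_deriv \<sigma> \<phi> t)"
    unfolding set_lebesgue_integral_def
    by (rule Bochner_Integration.integral_cong) (auto simp: indicator_def R(4))
  ultimately show ?thesis
    using integrable_bounded_support[OF c b] by simp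
qed

text \<open>The function \<open>w\<close> attached to one ray: \<open>S v = v ^ k\<close> with
  \<open>k \<le> 3\<close> gives the components of the vector jump identity, higher even powers give
  the entropy inequalities.\<close>

definition ray_defect ::
  "real ^ 4 \<Rightarrow> real ^ 4 \<Rightarrow> real \<Rightarrow> (real \<Rightarrow> real) \<Rightarrow> (real \<Rightarrow> real) \<Rightarrow> real \<Rightarrow> real" where
  "ray_defect M M' \<sigma> m S t = \<sigma> * (eta S M - eta S M') * t - (q S M - q S M') * t + eta_delta S m \<sigma> t"

text \<open>Because \<open>q_delta\<close> is \<open>\<sigma>\<close> times
  \<open>eta_delta\<close>, the two singular terms merge into \<open>eta_delta\<close> times
  \<open>ray_deriv\<close>. The part of the defect proportional to \<open>t\<close> is integrated by
  parts.\<close>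

lemma ray_production:
  assumes \<phi>: "test_function \<phi>" and m: "continuous_on {0..} m"
  shows "(LINT t:{0<..}|lborel. ray_defect M M' \<sigma> m S t * ray_deriv \<sigma> \<phi> t)
      = (LINT t:{0<..}|lborel. eta_delta S m \<sigma> t * pd_t \<phi> (\<sigma> * t, t))
      + (LINT t:{0<..}|lborel. q_delta S m \<sigma> t * pd_x \<phi> (\<sigma> * t, t))
      - (\<sigma> * (eta S M - eta S M') - (q S M - q S M')) * (LINT t|lborel. \<phi> (\<sigma> * t, t))"
proof -
  note D = test_functionD[OF \<phi>] and R = ray_deriv_props[OF \<phi>, where \<sigma> = \<sigma>]
  define c where "c = \<sigma> * (eta S M - eta S M') - (q S M - q S M')"
  have i: "set_integrable lborel {0<..} (\<lambda>t. eta_delta S m \<sigma> t * pd_t \<phi> (\<sigma> * t, t))"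
    "set_integrable lborel {0<..} (\<lambda>t. q_delta S m \<sigma> t * pd_x \<phi> (\<sigma> * t, t))"
    "set_integrable lborel {0<..} (\<lambda>t. c * (t * ray_deriv \<sigma> \<phi> t))"
    unfolding eta_delta_def q_delta_def mult.assoc[of c, symmetric]
    using m bounded_support_slices(2)[OF D(6)] bounded_support_slices(2)[OF D(7)]
    by (intro set_integrable_half_line;
        auto intro!: continuous_intros continuous_on_compose2[OF D(3)] continuous_on_compose2[OF D(4)]
          R D(9,10))+
  have "(LINT t:{0<..}|lborel. ray_defect M M' \<sigma> m S t * ray_deriv \<sigma> \<phi> t)
     = (LINT t:{0<..}|lborel. c * (t * ray_deriv \<sigma> \<phi> t)
          + (eta_delta S m \<sigma> t * pd_t \<phi> (\<sigma> * t, t) + q_delta S m \<sigma> t * pd_x \<phi> (\<sigma> * t, t)))"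
    by (rule arg_cong[where f = "set_lebesgue_integral lborel {0<..}"])
      (auto simp: ray_defect_def ray_deriv_def c_def eta_delta_def q_delta_def algebra_simps)
  also have "\<dots> = c * (LINT t:{0<..}|lborel. t * ray_deriv \<sigma> \<phi> t)
      + ((LINT t:{0<..}|lborel. eta_delta S m \<sigma> t * pd_t \<phi> (\<sigma> * t, t))
        + (LINT t:{0<..}|lborel. q_delta S m \<sigma> t * pd_x \<phi> (\<sigma> * t, t)))"
    using i by (simp add: set_integral_add)
  finally show ?thesis
    by (simp add: c_def[symmetric] ray_integral_by_parts[OF \<phi>])
qed

text \<open>On each ray the half plane formulas contribute the jump of \<open>q\<close> minus
  \<open>\<sigma>\<close> times the jump of \<open>eta\<close>, multiplied by the integral of
  \<open>\<phi>\<close>; \<open>ray_production\<close> joins this with the singular terms.\<close>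

lemma entropy_production_eq:
  assumes \<phi>: "test_function \<phi>" and "\<sigma>L < \<sigma>R"
    and m: "continuous_on {0..} m_L" "continuous_on {0..} m_R"
  shows "entropy_production M_L M_star M_R \<sigma>L \<sigma>R m_L m_R S \<phi>
      = - (LINT t:{0<..}|lborel. ray_defect M_L M_star \<sigma>L m_L S t * ray_deriv \<sigma>L \<phi> t)
        - (LINT t:{0<..}|lborel. ray_defect M_star M_R \<sigma>R m_R S t * ray_deriv \<sigma>R \<phi> t)"
proof -
  note D = test_functionD[OF \<phi>]
  have "(LINT p:UNIV \<times> {0<..}|lborel. sector_density \<sigma>L \<sigma>R uL uS uR p * pd_t \<phi> p)
      = - \<sigma>L * (uL - uS) * (LINT t|lborel. \<phi> (\<sigma>L * t, t)) - \<sigma>R * (uS - uR) * (LINT t|lborel. \<phi> (\<sigma>R * t, t))"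
    for uL uS uR
    using sector_integral[OF D(4) D(7) _ \<open>\<sigma>L < \<sigma>R\<close>, of uL uS uR] D(10)
    by (simp add: LINT_half_plane_ft[OF D(1,3-7)] LINT_plane_ft[OF D(1,3-7)])
  moreover have "(LINT p:UNIV \<times> {0<..}|lborel. sector_density \<sigma>L \<sigma>R uL uS uR p * pd_x \<phi> p)
      = (uL - uS) * (LINT t|lborel. \<phi> (\<sigma>L * t, t)) + (uS - uR) * (LINT t|lborel. \<phi> (\<sigma>R * t, t))"
    for uL uS uR
    using sector_integral[OF D(3) D(6) _ \<open>\<sigma>L < \<sigma>R\<close>, of uL uS uR] D(9)
    by (simp add: LINT_half_plane_fx[OF D(1,3-7)] LINT_plane_fx[OF D(1,3-7)])
  ultimately show ?thesis
    unfolding ray_production[OF \<phi> m(1)] ray_production[OF \<phi> m(2)] entropy_production_def pairing_def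
    by (simp only:) (simp add: algebra_simps)
qed

subsection \<open>Test functions concentrated on a ray\<close>

text \<open>\<open>\<psi>\<close> is the difference of two translates of a primitive of a bump on
  \<open>(0, \<delta>)\<close>. As \<open>t0 + \<delta> < t1\<close>, the rise is over before the
  fall begins, so the two bumps in \<open>\<psi>'\<close> do not cancel.\<close>

lemma plateau_ex:
  fixes t0 t1 \<delta> :: real
  assumes "\<delta> > 0" "t0 + \<delta> < t1"
  obtains \<psi> \<psi>' where "\<And>k. C_k k (\<lambda>p. \<psi> (snd p))"
    and "\<And>t. (\<psi> has_real_derivative \<psi>' t) (at t)" and "\<And>t. \<psi> t \<ge> 0"
    and "\<And>t. t \<notin> {t0..t1 + \<delta>} \<Longrightarrow> \<psi> t = 0"
    and "\<And>t. \<psi>' t > 0 \<longleftrightarrow> t \<in> {t0<..<t0 + \<delta>}" and "\<And>t. \<psi>' t < 0 \<longleftrightarrow> t \<in> {t1<..<t1 + \<delta>}"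
proof -
  define \<rho> where "\<rho> s = flat 0 s * flat 0 (\<delta> - s)" for s
  have \<rho>0: "\<rho> s \<ge> 0" for s
    unfolding \<rho>_def by (intro mult_nonneg_nonneg flat_0_nonneg)
  have \<rho>pos: "\<rho> s > 0 \<longleftrightarrow> s \<in> {0<..<\<delta>}" for s
    by (simp add: \<rho>_def zero_less_mult_iff flat_0_pos_iff flat_0_nonneg[THEN leD])
  have "isCont (flat 0) s" for s
    using flat_has_derivative by (rule DERIV_isCont)
  then have "isCont (\<lambda>s. flat 0 s * flat 0 (\<delta> - s)) s" for s
    by (intro isCont_mult isCont_o2[where f = "\<lambda>s. \<delta> - s" and g = "flat 0"] continuous_diff
        continuous_const continuous_ident)
  then have "isCont \<rho> s" for s
    by (simp add: \<rho>_def[abs_def])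
  then have "\<exists>R. \<forall>s. - \<infinity> < ereal s \<longrightarrow> ereal s < \<infinity> \<longrightarrow> (R has_vector_derivative \<rho> s) (at s)"
    by (intro einterval_antiderivative) auto
  then obtain R where R: "\<And>s. (R has_real_derivative \<rho> s) (at s)"
    by (auto simp: has_real_derivative_iff_has_vector_derivative)
  have mono: "R s \<le> R s'" if "s \<le> s'" for s s'
    using that by (rule DERIV_nonneg_imp_nondecreasing) (use R \<rho>0 in blast)
  have const: "R s = R s'" if "s \<le> s'" "s' \<le> 0 \<or> \<delta> \<le> s" for s s'
  proof -
    have "R s' \<le> R s"
    proof (rule DERIV_nonpos_imp_nonincreasing[OF that(1)])
      fix x assume "s \<le> x" "x \<le> s'"
      then have "\<not> \<rho> x > 0" using that(2) by (auto simp: \<rho>pos)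
      then show "\<exists>y. (R has_real_derivative y) (at x) \<and> y \<le> 0" using R by (auto simp: not_less)
    qed
    then show ?thesis using mono[OF that(1)] by simp
  qed
  define \<psi> where "\<psi> t = R (t - t0) - R (t - t1)" for t
  \<comment> \<open>The difference is spelled as a sum with factor \<open>- 1\<close> so that
    \<open>C_k_add\<close>, \<open>C_k_mult\<close> and \<open>C_k_const\<close> apply.\<close>
  define \<psi>' where "\<psi>' t = \<rho> (t - t0) + - 1 * \<rho> (t - t1)" for t
  have d: "(\<psi> has_real_derivative \<psi>' t) (at t)" for t
    unfolding \<psi>_def \<psi>'_def
    by (auto intro!: derivative_eq_intros DERIV_chain2[OF R])
  have "C_k k (\<lambda>p. \<rho> (snd p - a))" for k a
  proof -
    have "(\<lambda>p :: real \<times> real. \<rho> (snd p - a))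
        = (\<lambda>p. (1 * flat 0 (0 * fst p + 1 * snd p + (- a))) * (1 * flat 0 (0 * fst p + (- 1) * snd p + (\<delta> + a))))"
      by (auto simp: \<rho>_def algebra_simps)
    then show ?thesis by (simp only: C_k_mult C_k_flat_affine)
  qed
  then have C': "C_k k (\<lambda>p. \<psi>' (snd p))" for k
    unfolding \<psi>'_def by (intro C_k_add C_k_mult C_k_const)
  have C: "C_k (Suc k) (\<lambda>p. \<psi> (snd p))" for k
  proof (rule C_k_SucI)
    fix p :: "real \<times> real"
    show "((\<lambda>p. \<psi> (snd p)) has_derivative (\<lambda>h. 0 * fst h + \<psi>' (snd p) * snd h)) (at p)"
      using has_derivative_compose[OF has_derivative_snd[OF has_derivative_ident]
          has_field_derivative_imp_has_derivative[OF d], of p UNIV] by simp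
  qed (rule C_k_const C')+
  have sgn: "\<psi>' t > 0 \<longleftrightarrow> t \<in> {t0<..<t0 + \<delta>}" "\<psi>' t < 0 \<longleftrightarrow> t \<in> {t1<..<t1 + \<delta>}" for t
    using \<rho>pos[of "t - t0"] \<rho>pos[of "t - t1"] \<rho>0[of "t - t0"] \<rho>0[of "t - t1"] assms
    by (auto simp: \<psi>'_def)
  show ?thesis
  proof (rule that[OF C_k_SucD[OF C] d _ _ sgn])
    show "\<psi> t \<ge> 0" for t
      using mono[of "t - t1" "t - t0"] assms by (simp add: \<psi>_def)
    show "\<psi> t = 0" if "t \<notin> {t0..t1 + \<delta>}" for t
      using const[of "t - t1" "t - t0"] that assms by (auto simp: \<psi>_def)
  qed
qed

text \<open>A plateau in time is multiplied by a cutoff in \<open>x - \<sigma> * t\<close>. The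
  cutoff is a positive constant on the ray of speed \<open>\<sigma>\<close>, so the sign of
  \<open>\<psi>'\<close> survives there, and it is narrow enough to miss the other ray.\<close>

lemma ray_test_function_ex:
  fixes \<sigma> \<sigma>' t0 t1 \<delta> :: real
  assumes "\<sigma> \<noteq> \<sigma>'" "t0 > 0" "\<delta> > 0" "t0 + \<delta> < t1"
  obtains \<phi> where "test_function \<phi>" "\<And>p. \<phi> p \<ge> 0" "\<And>t. ray_deriv \<sigma>' \<phi> t = 0"
    and "\<And>t. ray_deriv \<sigma> \<phi> t > 0 \<longleftrightarrow> t \<in> {t0<..<t0 + \<delta>}"
    and "\<And>t. ray_deriv \<sigma> \<phi> t < 0 \<longleftrightarrow> t \<in> {t1<..<t1 + \<delta>}"
proof -
  obtain \<psi> \<psi>' where C: "\<And>k. C_k k (\<lambda>p. \<psi> (snd p))"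
    and d: "\<And>t. (\<psi> has_real_derivative \<psi>' t) (at t)" and \<psi>0: "\<And>t. \<psi> t \<ge> 0"
    and supp: "\<And>t. t \<notin> {t0..t1 + \<delta>} \<Longrightarrow> \<psi> t = 0"
    and sgn: "\<And>t. \<psi>' t > 0 \<longleftrightarrow> t \<in> {t0<..<t0 + \<delta>}" "\<And>t. \<psi>' t < 0 \<longleftrightarrow> t \<in> {t1<..<t1 + \<delta>}"
    using plateau_ex[OF assms(3,4)] by blast
  \<comment> \<open>At every time \<open>t \<ge> t0\<close> the two rays are at least this far
    apart; before \<open>t0\<close> the plateau is 0.\<close>
  define \<epsilon> where "\<epsilon> = \<bar>\<sigma>' - \<sigma>\<bar> * t0"
  have \<epsilon>: "\<epsilon> > 0" using assms by (simp add: \<epsilon>_def)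
  \<comment> \<open>The cutoff is written with explicit coefficients to match the pattern of
    \<open>C_k_flat_affine\<close>.\<close>
  define \<phi> where "\<phi> p = \<psi> (snd p) *
      ((1 * flat 0 (1 * fst p + (- \<sigma>) * snd p + \<epsilon>)) * (1 * flat 0 ((- 1) * fst p + \<sigma> * snd p + \<epsilon>)))" for p
  have C\<phi>: "C_k k \<phi>" for k
    unfolding \<phi>_def by (intro C_k_mult C_k_flat_affine C)
  have ray: "\<phi> (s * t, t) = \<psi> t * (flat 0 ((s - \<sigma>) * t + \<epsilon>) * flat 0 (\<epsilon> - (s - \<sigma>) * t))" for s t
    by (simp add: \<phi>_def algebra_simps)
  have test: "test_function \<phi>"
  proof -
    let ?K = "(\<lambda>p. (fst p + \<sigma> * snd p, snd p)) ` ({-\<epsilon>..\<epsilon>} \<times> {t0..t1 + \<delta>})"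
    have K: "compact ?K"
      by (intro compact_continuous_image compact_Times compact_Icc continuous_intros)
    have sub: "{p. \<phi> p \<noteq> 0} \<subseteq> ?K"
    proof safe
      fix x t assume "\<phi> (x, t) \<noteq> 0"
      then have "\<psi> t \<noteq> 0" "flat 0 (x - \<sigma> * t + \<epsilon>) \<noteq> 0" "flat 0 (- x + \<sigma> * t + \<epsilon>) \<noteq> 0"
        by (auto simp: \<phi>_def)
      then have "t \<in> {t0..t1 + \<delta>}" "x - \<sigma> * t \<in> {-\<epsilon>..\<epsilon>}"
        using supp[of t] by (auto simp: flat_0_eq_0_iff)
      then show "(x, t) \<in> ?K"
        by (intro image_eqI[of _ _ "(x - \<sigma> * t, t)"]) auto
    qed
    have "closure {p. \<phi> p \<noteq> 0} \<subseteq> ?K"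
      using sub K by (intro closure_minimal compact_imp_closed)
    moreover have "?K \<subseteq> UNIV \<times> {0<..}" using assms by auto
    moreover have "compact (closure {p. \<phi> p \<noteq> 0})"
      using bounded_subset[OF compact_imp_bounded[OF K] sub] by simp
    ultimately show ?thesis using C\<phi> unfolding test_function_def by blast
  qed
  have rd: "ray_deriv \<sigma> \<phi> t = \<psi>' t * (flat 0 \<epsilon> * flat 0 \<epsilon>)" for t
  proof (rule DERIV_unique[OF ray_has_derivative[OF test]])
    show "((\<lambda>t. \<phi> (\<sigma> * t, t)) has_real_derivative \<psi>' t * (flat 0 \<epsilon> * flat 0 \<epsilon>)) (at t)"
      unfolding ray by (simp, rule DERIV_cmult_right[OF d])
  qed
  have pos: "flat 0 \<epsilon> * flat 0 \<epsilon> > 0"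
    using \<epsilon> flat_0_pos_iff by simp
  have other: "\<phi> (\<sigma>' * t, t) = 0" for t
  proof (cases "t < t0")
    case True
    then show ?thesis using supp by (simp add: ray)
  next
    case False
    then have "\<bar>(\<sigma>' - \<sigma>) * t\<bar> \<ge> \<epsilon>"
      using assms by (auto simp: \<epsilon>_def abs_mult intro!: mult_left_mono)
    then have "(\<sigma>' - \<sigma>) * t + \<epsilon> \<le> 0 \<or> \<epsilon> - (\<sigma>' - \<sigma>) * t \<le> 0" by linarith
    then show ?thesis by (auto simp: ray flat_0_eq_0_iff)
  qed
  show ?thesis
  proof (rule that[OF test])
    show "\<phi> p \<ge> 0" for p
      using \<psi>0 flat_0_nonneg by (simp add: \<phi>_def)
    show "ray_deriv \<sigma>' \<phi> t = 0" for t
      using ray_has_derivative[OF test, of \<sigma>' t] unfolding other by (rule DERIV_unique) simp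
    show "ray_deriv \<sigma> \<phi> t > 0 \<longleftrightarrow> t \<in> {t0<..<t0 + \<delta>}" "ray_deriv \<sigma> \<phi> t < 0 \<longleftrightarrow> t \<in> {t1<..<t1 + \<delta>}" for t
      using pos sgn[of t] unfolding rd by (auto simp: zero_less_mult_iff mult_less_0_iff)
  qed
qed

text \<open>
  A test function on the ray rises where \<open>w\<close> is below the level \<open>c = w T / 2\<close> and falls where \<open>w\<close> is
  above it, so pairing \<open>w - c\<close> with its derivative gives a strictly negative number.
\<close>

lemma nonpos_of_ray_pairing:
  fixes w :: "real \<Rightarrow> real"
  assumes w: "continuous_on {0..} w" and w0: "w 0 = 0" and "\<sigma> \<noteq> \<sigma>'"
    and pair: "\<And>\<phi>. test_function \<phi> \<Longrightarrow> (\<And>p. \<phi> p \<ge> 0) \<Longrightarrow> (\<And>t. ray_deriv \<sigma>' \<phi> t = 0) \<Longrightarrow>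
      (LINT t:{0<..}|lborel. w t * ray_deriv \<sigma> \<phi> t) \<ge> 0"
    and "T \<ge> 0"
  shows "w T \<le> 0"
proof (rule ccontr)
  assume "\<not> w T \<le> 0"
  then have wT: "w T > 0" by simp
  define c where "c = w T / 2"
  have c: "c > 0" "c < w T" using wT by (simp_all add: c_def)
  obtain d where d: "d > 0" "\<And>t. t \<ge> 0 \<Longrightarrow> t < d \<Longrightarrow> w t < c"
    using w[unfolded continuous_on_iff, rule_format, of 0 c] c w0
    by (force simp: dist_real_def)
  obtain e where e: "e > 0" "\<And>t. t \<ge> T \<Longrightarrow> t < T + e \<Longrightarrow> w t > c"
  proof -
    obtain e where e: "e > 0" "\<And>t. t \<ge> 0 \<Longrightarrow> \<bar>t - T\<bar> < e \<Longrightarrow> \<bar>w t - w T\<bar> < w T - c"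
      using w[unfolded continuous_on_iff, rule_format, of T "w T - c"] c \<open>T \<ge> 0\<close>
      by (auto simp: dist_real_def)
    show ?thesis
    proof (rule that[OF e(1)])
      fix t assume "t \<ge> T" "t < T + e"
      then show "w t > c" using e(2)[of t] \<open>T \<ge> 0\<close> by (simp add: abs_less_iff)
    qed
  qed
  \<comment> \<open>Otherwise \<open>T\<close> would lie in the interval where \<open>w\<close>
    stays below \<open>c\<close>, although \<open>w T > c\<close>.\<close>
  have "T \<ge> d" using d(2)[of T] c \<open>T \<ge> 0\<close> by force
  \<comment> \<open>A third of the minimum puts the rise \<open>(\<delta>, 2 * \<delta>)\<close>
    where \<open>w < c\<close> and the fall \<open>(T, T + \<delta>)\<close> where
    \<open>w > c\<close>. With \<open>T \<ge> d\<close> it also gives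
    \<open>2 * \<delta> < T\<close>, so the rise ends before the fall starts.\<close>
  define \<delta> where "\<delta> = min d e / 3"
  have \<delta>: "\<delta> > 0" "\<delta> + \<delta> < d" "\<delta> < e" "\<delta> + \<delta> < T"
    using d(1) e(1) \<open>T \<ge> d\<close> by (auto simp: \<delta>_def)
  obtain \<phi> where \<phi>: "test_function \<phi>" "\<And>p. \<phi> p \<ge> 0" "\<And>t. ray_deriv \<sigma>' \<phi> t = 0"
    and up: "\<And>t. ray_deriv \<sigma> \<phi> t > 0 \<longleftrightarrow> t \<in> {\<delta><..<\<delta> + \<delta>}"
    and down: "\<And>t. ray_deriv \<sigma> \<phi> t < 0 \<longleftrightarrow> t \<in> {T<..<T + \<delta>}"
    using ray_test_function_ex[OF \<open>\<sigma> \<noteq> \<sigma>'\<close> \<delta>(1,1,4)] by blast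
  note D = test_functionD[OF \<phi>(1)] and R = ray_deriv_props[OF \<phi>(1), where \<sigma> = \<sigma>]
  let ?f = "\<lambda>t. indicator {0<..} t *\<^sub>R ((c - w t) * ray_deriv \<sigma> \<phi> t)"
  have int: "set_integrable lborel {0<..} (\<lambda>t. w t * ray_deriv \<sigma> \<phi> t)"
    "set_integrable lborel {0<..} (\<lambda>t. c * ray_deriv \<sigma> \<phi> t)"
    "set_integrable lborel {0<..} (\<lambda>t. (c - w t) * ray_deriv \<sigma> \<phi> t)"
    by (rule set_integrable_half_line; use w R in \<open>auto intro!: continuous_intros\<close>)+
  have "bounded {t. \<phi> (\<sigma> * t, t) \<noteq> 0}"
    using D(5) by (rule bounded_support_slices(2))
  \<comment> \<open>The derivative along the ray has total integral 0, so the constant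
    \<open>c\<close> may be subtracted from \<open>w\<close> without changing the pairing.\<close>
  then have "(LINT t|lborel. ray_deriv \<sigma> \<phi> t) = 0"
    using R by (intro integral_deriv_eq_0[where g = "\<lambda>t. \<phi> (\<sigma> * t, t)"]) auto
  moreover have "(LINT t|lborel. ray_deriv \<sigma> \<phi> t) = (LINT t:{0<..}|lborel. ray_deriv \<sigma> \<phi> t)"
    unfolding set_lebesgue_integral_def
    by (rule Bochner_Integration.integral_cong) (auto simp: indicator_def R(4))
  moreover have "(LINT t:{0<..}|lborel. (c - w t) * ray_deriv \<sigma> \<phi> t)
      = c * (LINT t:{0<..}|lborel. ray_deriv \<sigma> \<phi> t) - (LINT t:{0<..}|lborel. w t * ray_deriv \<sigma> \<phi> t)"
    using set_integral_diff(2)[OF int(2,1)] by (simp add: left_diff_distrib)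
  ultimately have le: "(LINT t|lborel. ?f t) \<le> 0"
    using pair[OF \<phi>] by (simp add: set_lebesgue_integral_def)
  have nonneg: "?f t \<ge> 0" for t
  proof (cases "ray_deriv \<sigma> \<phi> t" "0 :: real" rule: linorder_cases)
    case less
    then have "c < w t" using down[of t] e(2)[of t] \<delta> by auto
    then show ?thesis using less by (simp add: mult_nonpos_nonpos indicator_def)
  next
    case greater
    then have "w t < c" using up[of t] d(2)[of t] \<delta> by auto
    then show ?thesis using greater by (simp add: indicator_def)
  qed simp
  \<comment> \<open>A nonnegative integrand with nonpositive integral vanishes almost everywhere,
    but \<open>?f\<close> is strictly positive on the rise, an interval of positive length.\<close>
  have "(LINT t|lborel. ?f t) = 0"
    using le Bochner_Integration.integral_nonneg[of lborel ?f] nonneg by (simp add: antisym)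
  then have "AE t in lborel. ?f t = 0"
    using integral_nonneg_eq_0_iff_AE[of lborel ?f] int(3) nonneg by (simp add: set_integrable_def)
  then have "AE t in lborel. t \<notin> {\<delta><..<\<delta> + \<delta>}"
  proof eventually_elim
    fix t assume z: "?f t = 0"
    show "t \<notin> {\<delta><..<\<delta> + \<delta>}"
    proof
      assume t: "t \<in> {\<delta><..<\<delta> + \<delta>}"
      then have "ray_deriv \<sigma> \<phi> t > 0" "w t < c"
        using up[of t] d(2)[of t] \<delta> by auto
      with z t \<delta>(1) show False by (auto simp: indicator_def split: if_splits)
    qed
  qed
  then have "{\<delta><..<\<delta> + \<delta>} \<in> null_sets lborel"
    by (subst AE_iff_null_sets) auto
  then show False using \<delta>(1) by (simp add: null_sets_def)
qed

text \<open>A vanishing pairing satisfies the one-sided criterion for both \<open>w\<close> and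
  \<open>- w\<close>.\<close>

lemma zero_of_ray_pairing:
  fixes w :: "real \<Rightarrow> real"
  assumes w: "continuous_on {0..} w" "w 0 = 0" and "\<sigma> \<noteq> \<sigma>'"
    and pair: "\<And>\<phi>. test_function \<phi> \<Longrightarrow> (\<And>t. ray_deriv \<sigma>' \<phi> t = 0) \<Longrightarrow>
      (LINT t:{0<..}|lborel. w t * ray_deriv \<sigma> \<phi> t) = 0"
    and "T \<ge> 0"
  shows "w T = 0"
proof -
  have "w T \<le> 0"
    by (rule nonpos_of_ray_pairing[OF w \<open>\<sigma> \<noteq> \<sigma>'\<close> _ \<open>T \<ge> 0\<close>]) (simp add: pair)
  moreover have "- w T \<le> 0"
  proof (rule nonpos_of_ray_pairing[OF _ _ \<open>\<sigma> \<noteq> \<sigma>'\<close> _ \<open>T \<ge> 0\<close>, of "\<lambda>t. - w t"])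
    fix \<phi> assume "test_function \<phi>" "\<And>t. ray_deriv \<sigma>' \<phi> t = 0"
    moreover have "(LINT t:{0<..}|lborel. - w t * ray_deriv \<sigma> \<phi> t)
        = - (LINT t:{0<..}|lborel. w t * ray_deriv \<sigma> \<phi> t)"
      unfolding set_lebesgue_integral_def by simp
    ultimately show "(LINT t:{0<..}|lborel. - w t * ray_deriv \<sigma> \<phi> t) \<ge> 0"
      using pair[of \<phi>] by simp
  qed (use w in \<open>auto intro!: continuous_intros\<close>)
  ultimately show ?thesis by simp
qed

subsection \<open>The jump relations\<close>

text \<open>By unique existence the description operator returns an actual quadrature. The extra
  factor \<open>v\<close> in \<open>q\<close> shifts the moment index by one; \<open>k = 3\<close>
  leads to \<open>M4_bar\<close>.\<close>

lemma quadrature_moments: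
  assumes "M \<in> moment_space"
  shows "eta (\<lambda>v. v ^ 0) M = M $ 0" "eta (\<lambda>v. v ^ 1) M = M $ 1"
    "eta (\<lambda>v. v ^ 2) M = M $ 2" "eta (\<lambda>v. v ^ 3) M = M $ 3"
    "q (\<lambda>v. v ^ 0) M = flux M $ 0" "q (\<lambda>v. v ^ 1) M = flux M $ 1"
    "q (\<lambda>v. v ^ 2) M = flux M $ 2" "q (\<lambda>v. v ^ 3) M = flux M $ 3"
proof -
  obtain r1 r2 v1 v2 where Q: "quadrature M = (r1, r2, v1, v2)" by (cases "quadrature M")
  have "is_quadrature M (quadrature M)"
    unfolding quadrature_def using quadrature_ex1[OF assms] by (rule theI')
  then have "M = vec4 (r1 + r2) (r1 * v1 + r2 * v2) (r1 * v1\<^sup>2 + r2 * v2\<^sup>2) (r1 * v1 ^ 3 + r2 * v2 ^ 3)"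
    by (simp add: Q)
  then have "M $ 0 = r1 + r2" "M $ 1 = r1 * v1 + r2 * v2" "M $ 2 = r1 * v1\<^sup>2 + r2 * v2\<^sup>2"
    "M $ 3 = r1 * v1 ^ 3 + r2 * v2 ^ 3"
    by simp_all
  then show "eta (\<lambda>v. v ^ 0) M = M $ 0" "eta (\<lambda>v. v ^ 1) M = M $ 1"
    "eta (\<lambda>v. v ^ 2) M = M $ 2" "eta (\<lambda>v. v ^ 3) M = M $ 3"
    "q (\<lambda>v. v ^ 0) M = flux M $ 0" "q (\<lambda>v. v ^ 1) M = flux M $ 1"
    "q (\<lambda>v. v ^ 2) M = flux M $ 2" "q (\<lambda>v. v ^ 3) M = flux M $ 3"
    by (simp_all add: eta_def q_def flux_def M4_bar_def Q power2_eq_square power3_eq_cube power4_eq_xxxx mult.assoc)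
qed

text \<open>Component \<open>k\<close> of \<open>M_delta\<close> is
  \<open>m t * \<sigma> ^ k\<close>, the singular entropy for \<open>v ^ k\<close>, so the vector
  identity splits into four scalar ones.\<close>

lemma ray_jump_iff:
  assumes "M \<in> moment_space" "M' \<in> moment_space"
  shows "t *\<^sub>R \<sigma> *\<^sub>R (M - M') - t *\<^sub>R (flux M - flux M') + M_delta m \<sigma> t = 0
    \<longleftrightarrow> (\<forall>k\<in>{0, 1, 2, 3}. ray_defect M M' \<sigma> m (\<lambda>v. v ^ k) t = 0)"
proof -
  have zero: "(0 :: real ^ 4) = vec4 0 0 0 0"
    by (simp add: vec4_eq_iff)
  show ?thesis
    unfolding zero vec4_eq_iff
    by (simp add: ray_defect_def quadrature_moments[OF assms(1), simplified]
        quadrature_moments[OF assms(2), simplified] M_delta_def eta_delta_def algebra_simps)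
qed

lemma ray_defect_continuous:
  "continuous_on {0..} m \<Longrightarrow> continuous_on {0..} (ray_defect M M' \<sigma> m S)"
  unfolding ray_defect_def eta_delta_def by (auto intro!: continuous_intros)

text \<open>For \<open>S = 1\<close> a vanishing defect says that \<open>m\<close> is a constant
  multiple of \<open>t\<close>; then both summands of the defect are linear in \<open>t\<close> for
  every \<open>S\<close>.\<close>

lemma ray_defect_linear:
  assumes "\<And>t. t \<ge> 0 \<Longrightarrow> ray_defect M M' \<sigma> m (\<lambda>v. v ^ 0) t = 0" and "t \<ge> 0"
  shows "ray_defect M M' \<sigma> m S t = ray_defect M M' \<sigma> m S 1 * t"
proof -
  define c where "c S = \<sigma> * (eta S M - eta S M') - (q S M - q S M')" for S
  have r: "ray_defect M M' \<sigma> m S s = c S * s + m s * S \<sigma>" for S s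
    unfolding ray_defect_def eta_delta_def c_def by (simp add: left_diff_distrib)
  have "m s = - c (\<lambda>v. v ^ 0) * s" if "s \<ge> 0" for s
    using assms(1)[OF that] unfolding r by simp
  then have "m t = - c (\<lambda>v. v ^ 0) * t" "m 1 = - c (\<lambda>v. v ^ 0) * 1"
    using \<open>t \<ge> 0\<close> zero_le_one by blast+
  then show ?thesis
    unfolding r by (simp only:) (simp add: algebra_simps)
qed

text \<open>For linear \<open>w\<close>, integration by parts turns the pairing into
  \<open>- w 1\<close> times the integral of \<open>\<phi>\<close> along the ray, whose sign is
  known.\<close>

lemma ray_pairing_nonneg:
  assumes lin: "\<And>t. t \<ge> 0 \<Longrightarrow> w t = w 1 * t" and "w 1 \<le> 0"
    and \<phi>: "test_function \<phi>" "\<And>p. \<phi> p \<ge> 0"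
  shows "(LINT t:{0<..}|lborel. w t * ray_deriv \<sigma> \<phi> t) \<ge> 0"
proof -
  have "(LINT t:{0<..}|lborel. w t * ray_deriv \<sigma> \<phi> t)
      = (LINT t:{0<..}|lborel. w 1 * (t * ray_deriv \<sigma> \<phi> t))"
    by (rule set_lebesgue_integral_cong, simp) (metis lin greaterThan_iff less_imp_le mult.assoc)
  also have "\<dots> = - w 1 * (LINT t|lborel. \<phi> (\<sigma> * t, t))"
    by (simp add: ray_integral_by_parts[OF \<phi>(1)])
  also have "\<dots> \<ge> 0"
    using \<open>w 1 \<le> 0\<close> \<phi>(2) by (intro mult_nonneg_nonneg) auto
  finally show ?thesis .
qed

theorem theorem5p2:
  fixes M_L M_R M_star :: "real ^ 4" and \<sigma>L \<sigma>R :: real and m_L m_R :: "real \<Rightarrow> real"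
  assumes "M_L \<in> moment_space" and "M_R \<in> moment_space" and "M_star \<in> moment_space"
    and "\<sigma>L < \<sigma>R"
    and "continuous_on {0..} m_L" and "continuous_on {0..} m_R"
    and "\<And>t. t \<ge> 0 \<Longrightarrow> m_L t \<ge> 0" and "\<And>t. t \<ge> 0 \<Longrightarrow> m_R t \<ge> 0"
    and "m_L 0 = 0" and "m_R 0 = 0"
  shows "(measure_solution M_L M_star M_R \<sigma>L \<sigma>R m_L m_R \<longleftrightarrow>
            jump_identities M_L M_star M_R \<sigma>L \<sigma>R m_L m_R)
       \<and> (entropic_measure_solution M_L M_star M_R \<sigma>L \<sigma>R m_L m_R \<longleftrightarrow>
            jump_identities M_L M_star M_R \<sigma>L \<sigma>R m_L m_R \<and>
            (\<forall>\<alpha>::nat. \<alpha> \<ge> 2 \<longrightarrow> (\<forall>t\<ge>0. let S = (\<lambda>v. v ^ (2 * \<alpha>)) in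
               \<sigma>L * (eta S M_L - eta S M_star) * t - (q S M_L - q S M_star) * t + eta_delta S m_L \<sigma>L t \<le> 0 \<and>
               \<sigma>R * (eta S M_star - eta S M_R) * t - (q S M_star - q S M_R) * t + eta_delta S m_R \<sigma>R t \<le> 0)))"
proof -
  define wL wR where "wL k = ray_defect M_L M_star \<sigma>L m_L (\<lambda>v. v ^ k)"
    and "wR k = ray_defect M_star M_R \<sigma>R m_R (\<lambda>v. v ^ k)" for k :: nat
  let ?E = "\<lambda>k. entropy_production M_L M_star M_R \<sigma>L \<sigma>R m_L m_R (\<lambda>v. v ^ k)"
  let ?I = "\<lambda>w \<sigma> \<phi>. LINT t:{0<..}|lborel. w t * ray_deriv \<sigma> \<phi> t"
  have E: "?E k \<phi> = - ?I (wL k) \<sigma>L \<phi> - ?I (wR k) \<sigma>R \<phi>" if "test_function \<phi>" for k \<phi>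
    unfolding wL_def wR_def by (rule entropy_production_eq[OF that assms(4-6)])
  have cont: "continuous_on {0..} (wL k)" "continuous_on {0..} (wR k)" for k
    unfolding wL_def wR_def using assms by (auto intro: ray_defect_continuous)
  have init: "wL k 0 = 0" "wR k 0 = 0" for k
    using assms by (simp_all add: wL_def wR_def ray_defect_def eta_delta_def)
  have ne: "\<sigma>L \<noteq> \<sigma>R" "\<sigma>R \<noteq> \<sigma>L" using \<open>\<sigma>L < \<sigma>R\<close> by auto
  have jump: "jump_identities M_L M_star M_R \<sigma>L \<sigma>R m_L m_R
      \<longleftrightarrow> (\<forall>k\<in>{0, 1, 2, 3}. \<forall>t\<ge>0. wL k t = 0 \<and> wR k t = 0)"
    unfolding jump_identities_def ray_jump_iff[OF assms(1,3)] ray_jump_iff[OF assms(3,2)] wL_def wR_def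
    by blast
  have I0: "?I w \<sigma> \<phi> = 0" if "\<And>t. t \<ge> 0 \<Longrightarrow> w t = 0" for w \<sigma> \<phi>
    unfolding set_lebesgue_integral_def
    by (rule integral_eq_zero_AE) (auto simp: indicator_def that)
  have ms: "measure_solution M_L M_star M_R \<sigma>L \<sigma>R m_L m_R
      \<longleftrightarrow> jump_identities M_L M_star M_R \<sigma>L \<sigma>R m_L m_R"
  proof
    assume "measure_solution M_L M_star M_R \<sigma>L \<sigma>R m_L m_R"
    then have 0: "?I (wL k) \<sigma>L \<phi> + ?I (wR k) \<sigma>R \<phi> = 0" if "k \<in> {0, 1, 2, 3}" "test_function \<phi>" for k \<phi>
      using that E[OF that(2), of k] by (auto simp: measure_solution_def)
    \<comment> \<open>A test function with zero derivative along the right ray contributes nothing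
      there, which isolates the left ray; the right ray is treated symmetrically.\<close>
    have "wL k t = 0" if "k \<in> {0, 1, 2, 3}" "t \<ge> 0" for k t
    proof (rule zero_of_ray_pairing[OF cont(1) init(1) ne(1) _ that(2)])
      fix \<phi> assume "test_function \<phi>" "\<And>t. ray_deriv \<sigma>R \<phi> t = 0"
      then show "?I (wL k) \<sigma>L \<phi> = 0" using 0[OF that(1), of \<phi>] by simp
    qed
    moreover have "wR k t = 0" if "k \<in> {0, 1, 2, 3}" "t \<ge> 0" for k t
    proof (rule zero_of_ray_pairing[OF cont(2) init(2) ne(2) _ that(2)])
      fix \<phi> assume "test_function \<phi>" "\<And>t. ray_deriv \<sigma>L \<phi> t = 0"
      then show "?I (wR k) \<sigma>R \<phi> = 0" using 0[OF that(1), of \<phi>] by simp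
    qed
    ultimately show "jump_identities M_L M_star M_R \<sigma>L \<sigma>R m_L m_R"
      unfolding jump by blast
  next
    assume "jump_identities M_L M_star M_R \<sigma>L \<sigma>R m_L m_R"
    then show "measure_solution M_L M_star M_R \<sigma>L \<sigma>R m_L m_R"
      unfolding jump measure_solution_def by (simp add: E I0)
  qed
  have entropic: "(\<forall>\<phi>. test_function \<phi> \<and> (\<forall>p. \<phi> p \<ge> 0) \<longrightarrow> ?E k \<phi> \<le> 0)
      \<longleftrightarrow> (\<forall>t\<ge>0. wL k t \<le> 0 \<and> wR k t \<le> 0)"
    if ji: "jump_identities M_L M_star M_R \<sigma>L \<sigma>R m_L m_R" for k
  proof
    assume *: "\<forall>\<phi>. test_function \<phi> \<and> (\<forall>p. \<phi> p \<ge> 0) \<longrightarrow> ?E k \<phi> \<le> 0"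
    have 0: "?I (wL k) \<sigma>L \<phi> + ?I (wR k) \<sigma>R \<phi> \<ge> 0" if "test_function \<phi>" "\<And>p. \<phi> p \<ge> 0" for \<phi>
    proof -
      have "?E k \<phi> \<le> 0" using * that by blast
      then show ?thesis by (simp add: E[OF that(1)])
    qed
    have "wL k t \<le> 0" if "t \<ge> 0" for t
    proof (rule nonpos_of_ray_pairing[OF cont(1) init(1) ne(1) _ that])
      fix \<phi> assume "test_function \<phi>" "\<And>p. \<phi> p \<ge> 0" "\<And>t. ray_deriv \<sigma>R \<phi> t = 0"
      then show "?I (wL k) \<sigma>L \<phi> \<ge> 0" using 0[of \<phi>] by simp
    qed
    moreover have "wR k t \<le> 0" if "t \<ge> 0" for t
    proof (rule nonpos_of_ray_pairing[OF cont(2) init(2) ne(2) _ that])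
      fix \<phi> assume "test_function \<phi>" "\<And>p. \<phi> p \<ge> 0" "\<And>t. ray_deriv \<sigma>L \<phi> t = 0"
      then show "?I (wR k) \<sigma>R \<phi> \<ge> 0" using 0[of \<phi>] by simp
    qed
    ultimately show "\<forall>t\<ge>0. wL k t \<le> 0 \<and> wR k t \<le> 0" by blast
  next
    assume le: "\<forall>t\<ge>0. wL k t \<le> 0 \<and> wR k t \<le> 0"
    \<comment> \<open>The mass identity, \<open>k = 0\<close> in the jump identities, makes the
      defects of every order linear, so their signs at \<open>t = 1\<close> decide the sign of the
      production.\<close>
    have lin: "wL k t = wL k 1 * t" "wR k t = wR k 1 * t" if "t \<ge> 0" for t
    proof -
      have "wL 0 s = 0" "wR 0 s = 0" if "s \<ge> 0" for s
        using ji that unfolding jump by simp_all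
      then show "wL k t = wL k 1 * t" "wR k t = wR k 1 * t"
        using that unfolding wL_def wR_def by (blast intro: ray_defect_linear)+
    qed
    show "\<forall>\<phi>. test_function \<phi> \<and> (\<forall>p. \<phi> p \<ge> 0) \<longrightarrow> ?E k \<phi> \<le> 0"
    proof safe
      fix \<phi> :: "real \<times> real \<Rightarrow> real"
      assume \<phi>: "test_function \<phi>" "\<forall>p. \<phi> p \<ge> 0"
      have "wL k 1 \<le> 0" "wR k 1 \<le> 0" using le by simp_all
      then have "?I (wL k) \<sigma>L \<phi> \<ge> 0" "?I (wR k) \<sigma>R \<phi> \<ge> 0"
        using ray_pairing_nonneg[OF lin(1) _ \<phi>(1)] ray_pairing_nonneg[OF lin(2) _ \<phi>(1)] \<phi>(2)
        by blast+
      then show "?E k \<phi> \<le> 0" by (simp add: E[OF \<phi>(1)])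
    qed
  qed
  have "entropic_measure_solution M_L M_star M_R \<sigma>L \<sigma>R m_L m_R \<longleftrightarrow>
      jump_identities M_L M_star M_R \<sigma>L \<sigma>R m_L m_R \<and>
      (\<forall>\<alpha>\<ge>2. \<forall>t\<ge>0. wL (2 * \<alpha>) t \<le> 0 \<and> wR (2 * \<alpha>) t \<le> 0)"
  \<comment> \<open>Without the jump identities both sides fail, the left one because an entropic
    measure solution is a measure solution.\<close>
  proof (cases "jump_identities M_L M_star M_R \<sigma>L \<sigma>R m_L m_R")
    case True
    \<comment> \<open>For the four lowest powers the inequalities follow from the equalities,
      leaving the conditions with \<open>\<alpha> \<ge> 2\<close>.\<close>
    moreover have "\<forall>t\<ge>0. wL k t \<le> 0 \<and> wR k t \<le> 0" if "k \<in> {0, 1, 2, 3}" for k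
      using True that unfolding jump by fastforce
    ultimately show ?thesis
      unfolding entropic_measure_solution_def ms entropic[OF True] by blast
  qed (simp add: entropic_measure_solution_def ms)
  with ms show ?thesis
    by (simp add: wL_def wR_def ray_defect_def Let_def)
qed

end
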